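(* Let $\mathcal X^t\in\mathbb R^{p_1\times\cdots\times p_{d+m}}$ have Tucker rank $\mathbf r$ with Tucker decomposition $\mathcal X^t=\mathcal S^t\times_{k=1}^{d+m}U_k^t$, and assume the least squares problem $\min_{\mathcal X\in T_{\mathcal X^t}\mathbb M_{\mathbf r}}\frac12\|\mathcal Y-\mathscr AP_{T_{\mathcal X^t}}(\mathcal X)\|_F^2$ has a unique solution $\mathcal X^{t+0.5}$ (the RGN update). Then $$\mathcal X^{t+0.5}=\mathcal B^t\times_{k=1}^{d+m}U_k^t+\sum_{k=1}^{d+m}\mathcal S^t\times_kU_{k\perp}^tD_k^t\times_{j\ne k}U_j^t,$$ where: (1) $(\mathcal B^t,\{D_k^t\}_{k=1}^d)$ is the solution of the following least squares problem, whose design matrix has size $n\prod_{l=d+1}^{d+m}r_l\times\big(\prod_{k=1}^{d+m}r_k+\sum_{k=1}^dr_k(p_k-r_k)\big)$: minimize over $\mathcal B\in\mathbb R^{r_1\times\cdots\times r_{d+m}}$, $D_k\in\mathbb R^{(p_k-r_k)\times r_k}$ ($k=1,\dots,d$) $$\sum_{i=1}^n\Big\|\mathcal Y_i\times_{l=1}^mU_{l+d}^{t\top}-\langle\mathcal A_i\times_{j=1}^dU_j^{t\top},\mathcal B\rangle_*-\sum_{k=1}^d\langle\mathcal A_i\times_kU_{k\perp}^{t\top}\times_{j\ne k,\,j\le d}U_j^{t\top},\mathcal S^t\times_kD_k\rangle_*\Big\|_F^2,$$ and this objective equals $$\sum_{i=1}^n\sum_{\substack{j_l\in[r_{d+l}]\\l=1,\dots,m}}\Big(\big(\mathcal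 Y_i\times_{l=1}^mU_{l+d}^{t\top}\big)_{[j_1,\dots,j_m]}-\langle\mathcal A_i\times_{j=1}^dU_j^{t\top},\mathcal B_{[:,\dots,:,j_1,\dots,j_m]}\rangle-\sum_{k=1}^d\big\langle U_{k\perp}^{t\top}\mathcal M_k\big(\mathcal A_i\times_{j\ne k}U_j^{t\top}\big)\big(\mathcal M_k(\mathcal S^t_{[:,\dots,:,j_1,\dots,j_m]})\big)^\top,D_k\big\rangle\Big)^2;$$ (2) for $k=d+1,\dots,d+m$, $$D_k^{t\top}=\arg\min_{D_k^\top\in\mathbb R^{r_k\times(p_k-r_k)}}\sum_{i=1}^n\|Y_{ki}-A_{ki}D_k^\top\|_F^2,$$ where $A_{ki}=\big(\mathcal M_{k-d}(\langle\mathcal A_i\times_{j=1}^dU_j^{t\top},\mathcal S^t\rangle_* )\big)^\top\in\mathbb R^{\prod_{l=d+1,l\ne k}^{d+m}r_l\times r_k}$ and $Y_{ki}=\big(\mathcal M_{k-d}(\mathcal Y_i\times_{l\ne k-d}U_{l+d}^{t\top})\big)^\top U_{k\perp}^t\in\mathbb R^{\prod_{l=d+1,l\ne k}^{d+m}r_l\times(p_k-r_k)}$.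
   Context: $d\ge1,m\ge0$. $\mathcal A_i\in\mathbb R^{p_1\times\cdots\times p_d}$, $\mathcal Y_i\in\mathbb R^{p_{d+1}\times\cdots\times p_{d+m}}$, $i=1,\dots,n$; $\mathcal Y$ stacks the $\mathcal Y_i$ along a first mode. $\langle\cdot,\cdot\rangle_*$ is the contracted inner product: for an order-$d$ tensor $\mathcal A$ and order-$(d+m)$ tensor $\mathcal X$ with matching first $d$ dimensions, $(\langle\mathcal A,\mathcal X\rangle_* )_{[j_1,\dots,j_m]}=\sum_{k_1,\dots,k_d}\mathcal A_{[k_1,\dots,k_d]}\mathcal X_{[k_1,\dots,k_d,j_1,\dots,j_m]}$. $\mathscr A(\mathcal X)_{[i,:,\dots,:]}=\langle\mathcal A_i,\mathcal X\rangle_*$. $\mathcal M_k$ is the mode-$k$ matricization (columns indexed by the other modes, earlier modes fastest), $\times_k$ the mode-$k$ tensor–matrix product. In the Tucker decomposition, $\mathcal S^t\in\mathbb R^{r_1\times\cdots\times r_{d+m}}$ and $U_k^t\in\mathbb R^{p_k\times r_k}$ has orthonormal columns; $U_{k\perp}^t\in\mathbb R^{p_k\times(p_k-r_k)}$ is an orthonormal complement. $\mathbb M_{\mathbf r}$ is the manifold of tensors of Tucker rank $\mathbf r$, its tangent space at $\mathcal X^t$ is $$T_{\mathcal X^t}\mathbb M_{\mathbf r}=\Big\{\mathcal B\times_{k=1}^{d+m}U_k^t+\sum_{k=1}^{d+m}\mathcal S^t\times_kU_{k\perp}^tD_k\times_{j\ne k}U_j^t:\ \mathcal B\in\mathbb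 R^{r_1\times\cdots\times r_{d+m}},\ D_k\in\mathbb R^{(p_k-r_k)\times r_k}\Big\},$$ and $P_{T_{\mathcal X^t}}$ is the orthogonal projector onto it. *)

theory Defs
  imports
    "Jordan_Normal_Form.DL_Rank"
    "HOL-Library.Function_Algebras"
    "HOL-Library.FuncSet"
begin

text \<open>A real tensor of size \<open>ps = [p\<^sub>1, \<dots>, p\<^sub>N]\<close> is a function on index lists that vanishes outside
  the index range \<open>tensor_indices ps\<close>; thus equality and the vector space operations are those of
  functions. Entries and modes are numbered from 0, and the tensors of order 0 are the scalars.\<close>

type_synonym tensor = "nat list \<Rightarrow> real"

definition tensor_indices :: "nat list \<Rightarrow> nat list set" where
  "tensor_indices ps = {js. length js = length ps \<and> (\<forall>k<length ps. js ! k < ps ! k)}"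

definition tensors :: "nat list \<Rightarrow> tensor set" where
  "tensors ps = {X. \<forall>js. js \<notin> tensor_indices ps \<longrightarrow> X js = 0}"

definition tensor_inner :: "nat list \<Rightarrow> tensor \<Rightarrow> tensor \<Rightarrow> real" where
  "tensor_inner ps X Z = (\<Sum>js\<in>tensor_indices ps. X js * Z js)"

definition tensor_norm :: "nat list \<Rightarrow> tensor \<Rightarrow> real" where
  "tensor_norm ps X = sqrt (\<Sum>js\<in>tensor_indices ps. (X js)\<^sup>2)"

definition mat_inner :: "real mat \<Rightarrow> real mat \<Rightarrow> real" where
  "mat_inner M N = (\<Sum>i<dim_row M. \<Sum>j<dim_col M. M $$ (i, j) * N $$ (i, j))"

definition mat_norm :: "real mat \<Rightarrow> real" where
  "mat_norm M = sqrt (\<Sum>i<dim_row M. \<Sum>j<dim_col M. (M $$ (i, j))\<^sup>2)"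

text \<open>\<open>contract ps \<A> \<X>\<close> is the contracted inner product, where \<open>ps\<close> is the size of \<open>\<A>\<close>
  and \<open>\<X>\<close> has size \<open>ps @ qs\<close>.\<close>

definition contract :: "nat list \<Rightarrow> tensor \<Rightarrow> tensor \<Rightarrow> tensor" where
  "contract ps A X = (\<lambda>js. \<Sum>ks\<in>tensor_indices ps. A ks * X (ks @ js))"

definition slice :: "tensor \<Rightarrow> nat list \<Rightarrow> tensor" where
  "slice X js = (\<lambda>ks. X (ks @ js))"

definition stack :: "nat \<Rightarrow> (nat \<Rightarrow> tensor) \<Rightarrow> tensor" where
  "stack n Z = (\<lambda>js. case js of [] \<Rightarrow> 0 | i # is \<Rightarrow> if i < n then Z i is else 0)"

text \<open>\<open>multi_index ps\<close> enumerates \<open>tensor_indices ps\<close> by \<open>0, \<dots>, prod_list ps - 1\<close>, with the earlier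
  modes running fastest.\<close>

fun multi_index :: "nat list \<Rightarrow> nat \<Rightarrow> nat list" where
  "multi_index [] c = []"
| "multi_index (p # ps) c = (c mod p) # multi_index ps (c div p)"

definition tensor_to_list :: "nat list \<Rightarrow> tensor \<Rightarrow> real list" where
  "tensor_to_list ps X = map (\<lambda>c. X (multi_index ps c)) [0..<prod_list ps]"

definition mat_to_list :: "real mat \<Rightarrow> real list" where
  "mat_to_list M = concat (map list_of_vec (cols M))"

definition matricize :: "nat list \<Rightarrow> nat \<Rightarrow> tensor \<Rightarrow> real mat" where
  "matricize ps k X =
    (let qs = take k ps @ drop (Suc k) ps in
      mat (ps ! k) (prod_list qs)
        (\<lambda>(i, c). let js = multi_index qs c in X (take k js @ i # drop k js)))"

definition mode_prod :: "nat \<Rightarrow> real mat \<Rightarrow> tensor \<Rightarrow> tensor" where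
  "mode_prod k M X = (\<lambda>js. if k < length js \<and> js ! k < dim_row M
     then \<Sum>i<dim_col M. M $$ (js ! k, i) * X (js[k := i]) else 0)"

text \<open>\<open>modes_prod ks M X\<close> is \<open>X \<times>\<^bsub>k\<in>ks\<^esub> M\<^sub>k\<close>; for distinct modes the order is irrelevant.\<close>

definition modes_prod :: "nat list \<Rightarrow> (nat \<Rightarrow> real mat) \<Rightarrow> tensor \<Rightarrow> tensor" where
  "modes_prod ks M X = fold (\<lambda>k. mode_prod k (M k)) ks X"

definition other_modes :: "nat \<Rightarrow> nat \<Rightarrow> nat list" where
  "other_modes N k = filter (\<lambda>j. j \<noteq> k) [0..<N]"

definition tucker_rank :: "nat list \<Rightarrow> tensor \<Rightarrow> nat list" where
  "tucker_rank ps X = map (\<lambda>k. vec_space.rank (ps ! k) (matricize ps k X)) [0..<length ps]"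

definition tucker_manifold :: "nat list \<Rightarrow> nat list \<Rightarrow> tensor set" where
  "tucker_manifold ps rs = {X \<in> tensors ps. tucker_rank ps X = rs}"

definition orthonormal_columns :: "real mat \<Rightarrow> bool" where
  "orthonormal_columns U \<longleftrightarrow> U\<^sup>T * U = 1\<^sub>m (dim_col U)"

definition orthonormal_complement :: "real mat \<Rightarrow> real mat \<Rightarrow> bool" where
  "orthonormal_complement U V \<longleftrightarrow>
     V \<in> carrier_mat (dim_row U) (dim_row U - dim_col U) \<and> orthonormal_columns V \<and>
     U\<^sup>T * V = 0\<^sub>m (dim_col U) (dim_col V)"

definition tucker_decomposition ::
  "nat list \<Rightarrow> nat list \<Rightarrow> tensor \<Rightarrow> tensor \<Rightarrow> (nat \<Rightarrow> real mat) \<Rightarrow> bool" where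
  "tucker_decomposition ps rs X S U \<longleftrightarrow>
     S \<in> tensors rs \<and>
     (\<forall>k<length ps. U k \<in> carrier_mat (ps ! k) (rs ! k) \<and> orthonormal_columns (U k)) \<and>
     X = modes_prod [0..<length ps] U S"

definition tangent_vector ::
  "nat \<Rightarrow> tensor \<Rightarrow> (nat \<Rightarrow> real mat) \<Rightarrow> (nat \<Rightarrow> real mat) \<Rightarrow> tensor \<Rightarrow> (nat \<Rightarrow> real mat) \<Rightarrow> tensor" where
  "tangent_vector N S U V B D =
     modes_prod [0..<N] U B +
     (\<Sum>k<N. modes_prod (other_modes N k) U (mode_prod k (V k * D k) S))"

definition tangent_space ::
  "nat list \<Rightarrow> nat list \<Rightarrow> tensor \<Rightarrow> (nat \<Rightarrow> real mat) \<Rightarrow> (nat \<Rightarrow> real mat) \<Rightarrow> tensor set" where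
  "tangent_space ps rs S U V =
     {tangent_vector (length ps) S U V B D | B D.
        B \<in> tensors rs \<and> (\<forall>k<length ps. D k \<in> carrier_mat (ps ! k - rs ! k) (rs ! k))}"

definition orth_projector :: "nat list \<Rightarrow> tensor set \<Rightarrow> tensor \<Rightarrow> tensor" where
  "orth_projector ps T X = (THE Z. Z \<in> T \<and> (\<forall>W\<in>T. tensor_inner ps (X - Z) W = 0))"

definition measurement_op :: "nat list \<Rightarrow> nat \<Rightarrow> (nat \<Rightarrow> tensor) \<Rightarrow> tensor \<Rightarrow> tensor" where
  "measurement_op ps n A X = stack n (\<lambda>i. contract ps (A i) X)"

definition is_unique_arg_min :: "('a \<Rightarrow> real) \<Rightarrow> ('a \<Rightarrow> bool) \<Rightarrow> 'a \<Rightarrow> bool" where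
  "is_unique_arg_min f P x \<longleftrightarrow> is_arg_min f P x \<and> (\<forall>y. is_arg_min f P y \<longrightarrow> y = x)"

text \<open>Below, \<open>A\<close> and \<open>Y\<close> denote a single pair \<open>(\<A>\<^sub>i, \<Y>\<^sub>i)\<close> of sizes \<open>take d ps\<close> and \<open>drop d ps\<close>,
  and \<open>V k\<close> is the orthonormal complement of \<open>U k\<close>.\<close>

definition core_response :: "nat \<Rightarrow> nat \<Rightarrow> (nat \<Rightarrow> real mat) \<Rightarrow> tensor \<Rightarrow> tensor" where
  "core_response d m U Y = modes_prod [0..<m] (\<lambda>l. (U (l + d))\<^sup>T) Y"

definition core_covariate :: "nat \<Rightarrow> (nat \<Rightarrow> real mat) \<Rightarrow> tensor \<Rightarrow> tensor" where
  "core_covariate d U A = modes_prod [0..<d] (\<lambda>j. (U j)\<^sup>T) A"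

definition core_residual ::
  "nat \<Rightarrow> nat \<Rightarrow> nat list \<Rightarrow> nat list \<Rightarrow> tensor \<Rightarrow> (nat \<Rightarrow> real mat) \<Rightarrow> (nat \<Rightarrow> real mat) \<Rightarrow>
   tensor \<Rightarrow> tensor \<Rightarrow> tensor \<Rightarrow> (nat \<Rightarrow> real mat) \<Rightarrow> tensor" where
  "core_residual d m ps rs S U V A Y B D =
     core_response d m U Y
     - contract (take d rs) (core_covariate d U A) B
     - (\<Sum>k<d. contract ((take d rs)[k := ps ! k - rs ! k])
          (modes_prod (other_modes d k) (\<lambda>j. (U j)\<^sup>T) (mode_prod k ((V k)\<^sup>T) A))
          (mode_prod k (D k) S))"

definition core_objective ::
  "nat \<Rightarrow> nat \<Rightarrow> nat \<Rightarrow> nat list \<Rightarrow> nat list \<Rightarrow> tensor \<Rightarrow> (nat \<Rightarrow> real mat) \<Rightarrow> (nat \<Rightarrow> real mat) \<Rightarrow>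
   (nat \<Rightarrow> tensor) \<Rightarrow> (nat \<Rightarrow> tensor) \<Rightarrow> tensor \<Rightarrow> (nat \<Rightarrow> real mat) \<Rightarrow> real" where
  "core_objective d m n ps rs S U V A Y B D =
     (\<Sum>i<n. (tensor_norm (drop d rs) (core_residual d m ps rs S U V (A i) (Y i) B D))\<^sup>2)"

definition core_objective_entrywise ::
  "nat \<Rightarrow> nat \<Rightarrow> nat \<Rightarrow> nat list \<Rightarrow> nat list \<Rightarrow> tensor \<Rightarrow> (nat \<Rightarrow> real mat) \<Rightarrow> (nat \<Rightarrow> real mat) \<Rightarrow>
   (nat \<Rightarrow> tensor) \<Rightarrow> (nat \<Rightarrow> tensor) \<Rightarrow> tensor \<Rightarrow> (nat \<Rightarrow> real mat) \<Rightarrow> real" where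
  "core_objective_entrywise d m n ps rs S U V A Y B D =
     (\<Sum>i<n. \<Sum>js\<in>tensor_indices (drop d rs).
       (core_response d m U (Y i) js
        - tensor_inner (take d rs) (core_covariate d U (A i)) (slice B js)
        - (\<Sum>k<d. mat_inner
             ((V k)\<^sup>T
              * matricize ((take d rs)[k := ps ! k]) k
                  (modes_prod (other_modes d k) (\<lambda>j. (U j)\<^sup>T) (A i))
              * (matricize (take d rs) k (slice S js))\<^sup>T)
             (D k)))\<^sup>2)"

text \<open>The unknowns \<open>(B, D\<^sub>1, \<dots>, D\<^sub>d)\<close> and the stacked residuals as coordinate vectors. The design
  matrix \<open>M\<close> of the least squares problem is the matrix for which the residual vector is
  \<open>y - M x\<close>, with \<open>x\<close> the vector of unknowns.\<close>

definition core_unknowns :: "nat \<Rightarrow> nat list \<Rightarrow> tensor \<Rightarrow> (nat \<Rightarrow> real mat) \<Rightarrow> real vec" where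
  "core_unknowns d rs B D =
     vec_of_list (tensor_to_list rs B @ concat (map (\<lambda>k. mat_to_list (D k)) [0..<d]))"

definition core_residual_vec ::
  "nat \<Rightarrow> nat \<Rightarrow> nat \<Rightarrow> nat list \<Rightarrow> nat list \<Rightarrow> tensor \<Rightarrow> (nat \<Rightarrow> real mat) \<Rightarrow> (nat \<Rightarrow> real mat) \<Rightarrow>
   (nat \<Rightarrow> tensor) \<Rightarrow> (nat \<Rightarrow> tensor) \<Rightarrow> tensor \<Rightarrow> (nat \<Rightarrow> real mat) \<Rightarrow> real vec" where
  "core_residual_vec d m n ps rs S U V A Y B D =
     vec_of_list (tensor_to_list (n # drop d rs)
       (stack n (\<lambda>i. core_residual d m ps rs S U V (A i) (Y i) B D)))"

definition mode_covariate ::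
  "nat \<Rightarrow> nat list \<Rightarrow> tensor \<Rightarrow> (nat \<Rightarrow> real mat) \<Rightarrow> tensor \<Rightarrow> nat \<Rightarrow> real mat" where
  "mode_covariate d rs S U A k =
     (matricize (drop d rs) (k - d) (contract (take d rs) (core_covariate d U A) S))\<^sup>T"

definition mode_response ::
  "nat \<Rightarrow> nat \<Rightarrow> nat list \<Rightarrow> nat list \<Rightarrow> (nat \<Rightarrow> real mat) \<Rightarrow> (nat \<Rightarrow> real mat) \<Rightarrow> tensor \<Rightarrow> nat \<Rightarrow>
   real mat" where
  "mode_response d m ps rs U V Y k =
     (matricize ((drop d rs)[k - d := ps ! k]) (k - d)
        (modes_prod (other_modes m (k - d)) (\<lambda>l. (U (l + d))\<^sup>T) Y))\<^sup>T * V k"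

end

theory Submission
  imports Defs
begin

text \<open>Split every mode \<open>k\<close> of the ambient space as \<open>range U\<^sub>k \<oplus> range U\<^sub>k\<^sub>\<bottom>\<close>. A tangent vector has only one block
  that uses \<open>U\<close> in all modes, namely \<open>\<B>\<close>, and for each \<open>k\<close> one block that uses \<open>U\<^sub>k\<^sub>\<bottom>\<close> in mode \<open>k\<close> and
  \<open>U\<close> elsewhere, namely \<open>\<S> \<times>\<^sub>k D\<^sub>k\<close>. Contraction with \<open>\<A>\<^sub>i\<close> maps a tangent vector to a tensor of the same
  shape in the response modes: its core is affected by \<open>\<B>\<close> and \<open>D\<^sub>k\<close>, \<open>k \<le> d\<close>, while its block \<open>k > d\<close> is
  affected by \<open>D\<^sub>k\<close> only. Since the blocks are mutually orthogonal and embedded isometrically, Pythagoras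
  writes the objective as a constant plus the core objective in \<open>(\<B>, D\<^sub>1, \<dots>, D\<^sub>d)\<close> plus one objective
  in each \<open>D\<^sub>k\<close>, \<open>k > d\<close>, so that the problem decouples. Uniqueness is transferred through the
  parametrisation, which is injective because the Tucker rank of \<open>\<X>\<close> makes each \<open>\<M>\<^sub>k(\<S>)\<close> a matrix of full
  row rank.\<close>

section \<open>Index sets and single mode products\<close>

lemma tensor_indices_Nil [simp]: "tensor_indices [] = {[]}"
  by (auto simp: tensor_indices_def)

lemma tensor_indices_Cons:
  "tensor_indices (p # ps) = (\<lambda>(i, js). i # js) ` ({..<p} \<times> tensor_indices ps)"
proof (intro Set.set_eqI iffI)
  fix js assume "js \<in> tensor_indices (p # ps)"
  then show "js \<in> (\<lambda>(i, js). i # js) ` ({..<p} \<times> tensor_indices ps)"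
    by (cases js) (auto simp: tensor_indices_def image_iff)
next
  fix js assume "js \<in> (\<lambda>(i, js). i # js) ` ({..<p} \<times> tensor_indices ps)"
  then show "js \<in> tensor_indices (p # ps)"
    by (auto simp: tensor_indices_def nth_Cons split: nat.splits)
qed

lemma finite_tensor_indices [simp]: "finite (tensor_indices ps)"
  by (induction ps) (auto simp: tensor_indices_Cons)

lemma length_tensor_index: "js \<in> tensor_indices ps \<Longrightarrow> length js = length ps"
  by (simp add: tensor_indices_def)

lemma sum_tensor_indices_Cons:
  "(\<Sum>js\<in>tensor_indices (p # ps). f js) = (\<Sum>i<p. \<Sum>js\<in>tensor_indices ps. f (i # js))"
proof -
  have "inj_on (\<lambda>(i, js). i # js) ({..<p} \<times> tensor_indices ps)"
    by (auto simp: inj_on_def)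
  then show ?thesis
    by (simp add: tensor_indices_Cons sum.reindex sum.cartesian_product case_prod_unfold)
qed

lemma sum_tensor_indices_append:
  "(\<Sum>js\<in>tensor_indices (ps @ qs). f js) =
   (\<Sum>ks\<in>tensor_indices ps. \<Sum>js\<in>tensor_indices qs. f (ks @ js))"
  by (induction ps arbitrary: f) (simp_all add: sum_tensor_indices_Cons)

lemma append_in_tensor_indices_iff:
  "length ks = length ps \<Longrightarrow>
   ks @ js \<in> tensor_indices (ps @ qs) \<longleftrightarrow> ks \<in> tensor_indices ps \<and> js \<in> tensor_indices qs"
proof (induction ps arbitrary: ks)
  case (Cons p ps)
  then obtain k ks' where "ks = k # ks'" by (cases ks) auto
  with Cons show ?case by (auto simp: tensor_indices_Cons)
qed simp

text \<open>Writing \<open>c\<close> as \<open>c mod p + p * (c div p)\<close> cuts the range into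
  blocks of length \<open>p\<close>: the remainder is the index of the fastest mode, the quotient
  encodes the others. This links columns of matricizations and coordinate lists to sums over tensor
  entries.\<close>

lemma sum_multi_index:
  "(\<Sum>c<prod_list ps. f (multi_index ps c)) = (\<Sum>js\<in>tensor_indices ps. f js)"
proof (induction ps arbitrary: f)
  case (Cons p ps)
  have div_mod: "(\<Sum>c<p * q. g (c mod p) (c div p)) = (\<Sum>i<p. \<Sum>c<q. g i c)"
    for q and g :: "nat \<Rightarrow> nat \<Rightarrow> 'a"
  proof -
    have "(\<Sum>c<p * q. g (c mod p) (c div p)) =
        (\<Sum>c<q. sum (\<lambda>c. g (c mod p) (c div p)) {c * p..<c * p + p})"
      by (subst sum.nat_group) (simp add: mult.commute)
    also have "\<dots> = (\<Sum>c<q. \<Sum>i<p. g ((c * p + i) mod p) ((c * p + i) div p))"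
    proof (rule sum.cong[OF refl])
      fix c
      show "sum (\<lambda>c. g (c mod p) (c div p)) {c * p..<c * p + p} =
          (\<Sum>i<p. g ((c * p + i) mod p) ((c * p + i) div p))"
        by (subst sum.atLeastLessThan_shift_0) (simp add: lessThan_atLeast0)
    qed
    also have "\<dots> = (\<Sum>c<q. \<Sum>i<p. g i c)"
      by (intro sum.cong refl) simp
    also have "\<dots> = (\<Sum>i<p. \<Sum>c<q. g i c)"
      by (rule sum.swap)
    finally show ?thesis .
  qed
  show ?case
    using div_mod[of "\<lambda>i c. f (i # multi_index ps c)" "prod_list ps"]
    by (simp add: Cons.IH[of "\<lambda>js. f (_ # js)"] sum_tensor_indices_Cons)
qed simp

lemma list_update_in_tensor_indices:
  "js \<in> tensor_indices ps \<Longrightarrow> i < p \<Longrightarrow> js[k := i] \<in> tensor_indices (ps[k := p])"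
  by (cases "k < length ps")
    (auto simp: tensor_indices_def nth_list_update list_update_beyond)

text \<open>Mode \<open>k\<close> is isolated in the same form as in \<open>matricize\<close>:
  \<open>i\<close> is the row, and \<open>js\<close> is the multi-index of the column.\<close>

lemma sum_tensor_indices_insert:
  assumes "k < length ps"
  shows "(\<Sum>js\<in>tensor_indices ps. f js) =
    (\<Sum>i<ps ! k. \<Sum>js\<in>tensor_indices (take k ps @ drop (Suc k) ps). f (take k js @ i # drop k js))"
proof -
  have ps: "ps = take k ps @ ps ! k # drop (Suc k) ps"
    using assms(1) by (simp add: id_take_nth_drop)
  have "(\<Sum>js\<in>tensor_indices ps. f js) =
      (\<Sum>ks\<in>tensor_indices (take k ps). \<Sum>i<ps ! k. \<Sum>js\<in>tensor_indices (drop (Suc k) ps). f (ks @ i # js))"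
    by (subst ps) (simp add: sum_tensor_indices_append sum_tensor_indices_Cons)
  also have "\<dots> = (\<Sum>i<ps ! k. \<Sum>ks\<in>tensor_indices (take k ps).
      \<Sum>js\<in>tensor_indices (drop (Suc k) ps). f (ks @ i # js))"
    by (rule sum.swap)
  also have "\<dots> = (\<Sum>i<ps ! k. \<Sum>js\<in>tensor_indices (take k ps @ drop (Suc k) ps).
      f (take k js @ i # drop k js))"
    using assms by (auto simp: sum_tensor_indices_append length_tensor_index min_def intro!: sum.cong)
  finally show ?thesis .
qed

section \<open>Tensor spaces, inner product and norm\<close>

lemma tensors_zero: "0 \<in> tensors ps"
  by (simp add: tensors_def)

lemma tensors_add: "X \<in> tensors ps \<Longrightarrow> Z \<in> tensors ps \<Longrightarrow> X + Z \<in> tensors ps"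
  by (simp add: tensors_def)

lemma tensors_diff: "X \<in> tensors ps \<Longrightarrow> Z \<in> tensors ps \<Longrightarrow> X - Z \<in> tensors ps"
  by (simp add: tensors_def)

lemma tensors_sum: "(\<And>k. k \<in> K \<Longrightarrow> X k \<in> tensors ps) \<Longrightarrow> (\<Sum>k\<in>K. X k) \<in> tensors ps"
  by (induction K rule: infinite_finite_induct) (auto intro: tensors_zero tensors_add)

lemma sum_fun_apply: "(\<Sum>k\<in>K. X k) js = (\<Sum>k\<in>K. X k js)"
  for X :: "'k \<Rightarrow> 'i \<Rightarrow> 'a::comm_monoid_add"
  by (induction K rule: infinite_finite_induct) auto

lemma tensor_norm_sq: "(tensor_norm ps X)\<^sup>2 = tensor_inner ps X X"
  by (simp add: tensor_norm_def tensor_inner_def sum_nonneg power2_eq_square)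

lemma tensor_inner_commute: "tensor_inner ps X Z = tensor_inner ps Z X"
  by (simp add: tensor_inner_def mult.commute)

lemma tensor_inner_diff_right: "tensor_inner ps W (X - Z) = tensor_inner ps W X - tensor_inner ps W Z"
  by (simp add: tensor_inner_def algebra_simps sum_subtractf)

lemma tensor_inner_diff_left: "tensor_inner ps (X - Z) W = tensor_inner ps X W - tensor_inner ps Z W"
  by (simp add: tensor_inner_def algebra_simps sum_subtractf)

lemma tensor_inner_sum_right: "tensor_inner ps W (\<Sum>k\<in>K. X k) = (\<Sum>k\<in>K. tensor_inner ps W (X k))"
  unfolding tensor_inner_def sum_fun_apply sum_distrib_left by (rule sum.swap)

lemma tensor_inner_self_eq_0:
  assumes "X \<in> tensors ps" "tensor_inner ps X X = 0"
  shows "X = 0"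
proof
  fix js
  show "X js = 0 js"
    using assms by (cases "js \<in> tensor_indices ps")
      (auto simp: tensor_inner_def tensors_def sum_nonneg_eq_0_iff)
qed

section \<open>Products along a single mode\<close>

lemma mode_prod_commute:
  assumes "j \<noteq> k"
  shows "mode_prod j M (mode_prod k N X) = mode_prod k N (mode_prod j M X)"
proof
  fix js
  show "mode_prod j M (mode_prod k N X) js = mode_prod k N (mode_prod j M X) js"
    using assms
    by (auto simp: mode_prod_def sum_distrib_left list_update_swap[of j k] mult.left_commute
        intro: sum.swap)
qed

lemma mode_prod_mode_prod:
  assumes "dim_col M = dim_row N"
  shows "mode_prod k M (mode_prod k N X) = mode_prod k (M * N) X"
proof
  fix js
  show "mode_prod k M (mode_prod k N X) js = mode_prod k (M * N) X js"
    using assms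
    by (auto simp: mode_prod_def sum_distrib_left sum_distrib_right scalar_prod_def mult.assoc
        lessThan_atLeast0 intro: sum.swap)
qed

text \<open>Membership in \<open>tensors ps\<close> matters, because \<open>mode_prod\<close> cuts
  off every entry beyond the row range of its matrix.\<close>

lemma mode_prod_one:
  assumes "X \<in> tensors ps" "k < length ps"
  shows "mode_prod k (1\<^sub>m (ps ! k)) X = X"
proof
  fix js
  have "(\<Sum>i<ps ! k. 1\<^sub>m (ps ! k) $$ (js ! k, i) * X (js[k := i])) = X js" if "js ! k < ps ! k"
  proof -
    have "(\<Sum>i<ps ! k. 1\<^sub>m (ps ! k) $$ (js ! k, i) * X (js[k := i])) =
        (\<Sum>i<ps ! k. if i = js ! k then X js else 0)"
      using that by (intro sum.cong) auto
    with that show ?thesis by simp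
  qed
  then show "mode_prod k (1\<^sub>m (ps ! k)) X js = X js"
    using assms by (auto simp: mode_prod_def tensors_def tensor_indices_def)
qed

lemma mode_prod_zero_mat: "mode_prod k (0\<^sub>m a b) X = 0"
  by (rule ext) (auto simp: mode_prod_def)

lemma mode_prod_zero: "mode_prod k M 0 = 0"
  by (rule ext) (auto simp: mode_prod_def)

lemma mode_prod_add: "mode_prod k M (X + Z) = mode_prod k M X + mode_prod k M Z"
  by (rule ext) (auto simp: mode_prod_def algebra_simps sum.distrib)

lemma mode_prod_diff: "mode_prod k M (X - Z) = mode_prod k M X - mode_prod k M Z"
  by (rule ext) (auto simp: mode_prod_def algebra_simps sum_subtractf)

lemma mode_prod_diff_mat:
  assumes "M \<in> carrier_mat a b" "N \<in> carrier_mat a b"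
  shows "mode_prod k (M - N) X = mode_prod k M X - mode_prod k N X"
  using assms by (intro ext) (auto simp: mode_prod_def algebra_simps sum_subtractf)

lemma mode_prod_in_tensors:
  assumes "X \<in> tensors ps" "k < length ps" "dim_row M = a"
  shows "mode_prod k M X \<in> tensors (ps[k := a])"
proof -
  have "mode_prod k M X js = 0" if js: "js \<notin> tensor_indices (ps[k := a])" for js
  proof -
    have "X (js[k := i]) = 0" if "k < length js" "js ! k < a" for i
    proof -
      have "js[k := i] \<notin> tensor_indices ps"
      proof
        assume "js[k := i] \<in> tensor_indices ps"
        \<comment> \<open>The double update is \<open>js\<close> itself, so an index outside the new
          range cannot enter the old range by changing position \<open>k\<close>.\<close>
        then have "js[k := i, k := js ! k] \<in> tensor_indices (ps[k := a])"
          using that by (intro list_update_in_tensor_indices)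
        with js show False by simp
      qed
      with assms show ?thesis by (simp add: tensors_def)
    qed
    with assms show ?thesis by (auto simp: mode_prod_def)
  qed
  then show ?thesis by (simp add: tensors_def)
qed

lemma tensor_inner_insert:
  assumes "k < length ps"
  shows "tensor_inner ps X Z =
    (\<Sum>js\<in>tensor_indices (take k ps @ drop (Suc k) ps). \<Sum>i<ps ! k.
      X (take k js @ i # drop k js) * Z (take k js @ i # drop k js))"
  unfolding tensor_inner_def sum_tensor_indices_insert[OF assms]
  by (rule sum.swap)

text \<open>Multiplication by the transpose is the adjoint of the mode product. With mode
  \<open>k\<close> isolated, both sides are the same triple sum in different orders.\<close>

lemma tensor_inner_mode_prod:
  assumes M: "M \<in> carrier_mat (ps ! k) b" and k: "k < length ps"
  shows "tensor_inner ps (mode_prod k M X) Z =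
    tensor_inner (ps[k := b]) X (mode_prod k (M\<^sup>T) Z)"
proof -
  let ?q = "take k ps @ drop (Suc k) ps"
  have upd: "(take k js @ i # drop k js)[k := l] = take k js @ l # drop k js"
    "(take k js @ i # drop k js) ! k = i" "min (length js) k = k"
    if "js \<in> tensor_indices ?q" for js i l
    using that k by (auto simp: length_tensor_index list_update_append nth_append min_def)
  have "tensor_inner ps (mode_prod k M X) Z =
    (\<Sum>js\<in>tensor_indices ?q. \<Sum>i<ps ! k. \<Sum>l<b. M $$ (i, l) * X (take k js @ l # drop k js)
       * Z (take k js @ i # drop k js))"
    using M k by (auto simp: tensor_inner_insert mode_prod_def upd sum_distrib_right intro!: sum.cong)
  also have "\<dots> = (\<Sum>js\<in>tensor_indices ?q. \<Sum>l<b. \<Sum>i<ps ! k.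
      M $$ (i, l) * X (take k js @ l # drop k js) * Z (take k js @ i # drop k js))"
    by (intro sum.cong refl sum.swap)
  also have "\<dots> = tensor_inner (ps[k := b]) X (mode_prod k (M\<^sup>T) Z)"
    using M k by (auto simp: tensor_inner_insert mode_prod_def upd sum_distrib_left mult_ac intro!: sum.cong)
  finally show ?thesis .
qed

section \<open>Iterated mode products, contractions and matricizations\<close>

lemma modes_prod_Nil [simp]: "modes_prod [] M X = X"
  by (simp add: modes_prod_def)

lemma modes_prod_Cons [simp]: "modes_prod (k # ks) M X = modes_prod ks M (mode_prod k (M k) X)"
  by (simp add: modes_prod_def)

lemma modes_prod_append: "modes_prod (ks @ ls) M X = modes_prod ls M (modes_prod ks M X)"
  by (simp add: modes_prod_def)

lemma modes_prod_cong:
  "(\<And>k. k \<in> set ks \<Longrightarrow> M k = N k) \<Longrightarrow> modes_prod ks M X = modes_prod ks N X"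
  by (induction ks arbitrary: X) auto

text \<open>All steps of the fold commute: different modes do by \<open>mode_prod_commute\<close>,
  and equal modes trivially, since the matrix depends on the mode alone.\<close>

lemma modes_prod_mset:
  assumes "mset ks = mset ls"
  shows "modes_prod ks M X = modes_prod ls M X"
proof -
  have "mode_prod j (M j) \<circ> mode_prod k (M k) = mode_prod k (M k) \<circ> mode_prod j (M j)" for j k
    by (cases "j = k") (auto simp: mode_prod_commute)
  then show ?thesis
    unfolding modes_prod_def using fold_multiset_equiv[OF _ assms, of "\<lambda>k. mode_prod k (M k)"] by simp
qed

lemma mode_prod_modes_prod:
  "k \<notin> set ks \<Longrightarrow> mode_prod k P (modes_prod ks M X) = modes_prod ks M (mode_prod k P X)"
  by (induction ks arbitrary: X) (auto simp: mode_prod_commute)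

text \<open>Translates the products over \<open>j \<noteq> k\<close> of the definitions into a
  product over all modes with an updated family of matrices, to which the lemmas on full products
  apply.\<close>

lemma modes_prod_other_modes:
  assumes "k < N"
  shows "modes_prod (other_modes N k) M (mode_prod k P X) = modes_prod [0..<N] (M(k := P)) X"
proof -
  have "modes_prod (other_modes N k) M (mode_prod k P X) = modes_prod (k # other_modes N k) (M(k := P)) X"
    by (auto simp: other_modes_def intro: modes_prod_cong)
  also have "\<dots> = modes_prod [0..<N] (M(k := P)) X"
  proof (rule modes_prod_mset)
    have "set (k # other_modes N k) = set [0..<N]" "distinct (k # other_modes N k)"
      using assms by (auto simp: other_modes_def)
    then show "mset (k # other_modes N k) = mset [0..<N]"
      using set_eq_iff_mset_eq_distinct distinct_upt by blast
  qed
  finally show ?thesis .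
qed

lemma modes_prod_zero: "modes_prod ks M 0 = 0"
  by (induction ks) (simp_all only: modes_prod_Nil modes_prod_Cons mode_prod_zero)

lemma modes_prod_add: "modes_prod ks M (X + Z) = modes_prod ks M X + modes_prod ks M Z"
  by (induction ks arbitrary: X Z) (auto simp: mode_prod_add)

lemma modes_prod_diff: "modes_prod ks M (X - Z) = modes_prod ks M X - modes_prod ks M Z"
  by (induction ks arbitrary: X Z) (auto simp: mode_prod_diff)

lemma modes_prod_sum: "modes_prod ks M (\<Sum>a\<in>K. X a) = (\<Sum>a\<in>K. modes_prod ks M (X a))"
  by (induction K rule: infinite_finite_induct) 
    (simp_all only: sum.infinite sum.empty sum.insert modes_prod_add modes_prod_zero not_False_eq_True)

lemma modes_prod_in_tensors:
  assumes "X \<in> tensors qs" "length ps = length qs" "set ks \<subseteq> {..<length qs}"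
    and "\<And>k. k < length qs \<Longrightarrow> ps ! k = (if k \<in> set ks then dim_row (M k) else qs ! k)"
  shows "modes_prod ks M X \<in> tensors ps"
  using assms
proof (induction ks arbitrary: X qs)
  case Nil
  then have "ps = qs" by (auto intro: nth_equalityI)
  with Nil show ?case by simp
next
  case (Cons k ks)
  have "mode_prod k (M k) X \<in> tensors (qs[k := dim_row (M k)])"
    using Cons.prems by (intro mode_prod_in_tensors) auto
  moreover have "ps ! j = (if j \<in> set ks then dim_row (M j) else qs[k := dim_row (M k)] ! j)"
    if "j < length qs" for j
    using Cons.prems(4)[OF that] that by (auto simp: nth_list_update)
  ultimately show ?case
    using Cons.prems by (auto intro!: Cons.IH[where qs = "qs[k := dim_row (M k)]"])
qed

text \<open>Since the modes are distinct, each factor \<open>M k\<close> can be moved inwards past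
  the other modes until it meets \<open>N k\<close>.\<close>

lemma modes_prod_modes_prod:
  assumes "distinct ks" "\<And>k. k \<in> set ks \<Longrightarrow> dim_col (M k) = dim_row (N k)"
  shows "modes_prod ks M (modes_prod ks N X) = modes_prod ks (\<lambda>k. M k * N k) X"
  using assms
  by (induction ks arbitrary: X) (auto simp: mode_prod_modes_prod mode_prod_mode_prod)

lemma modes_prod_one:
  assumes "X \<in> tensors ps" "\<And>k. k \<in> set ks \<Longrightarrow> k < length ps \<and> M k = 1\<^sub>m (ps ! k)"
  shows "modes_prod ks M X = X"
  using assms(2) by (induction ks) (auto simp: mode_prod_one[OF assms(1)])

lemma modes_prod_zero_mat:
  assumes "k \<in> set ks" "M k = 0\<^sub>m a b"
  shows "modes_prod ks M X = 0"
  using assms by (induction ks arbitrary: X) (auto simp: mode_prod_zero_mat modes_prod_zero)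

lemma tensor_inner_modes_prod:
  assumes "distinct ks" "set ks \<subseteq> {..<length ps}" "length qs = length ps"
    and "\<And>k. k \<in> set ks \<Longrightarrow> M k \<in> carrier_mat (ps ! k) (qs ! k)"
    and "\<And>k. k < length ps \<Longrightarrow> k \<notin> set ks \<Longrightarrow> ps ! k = qs ! k"
  shows "tensor_inner ps (modes_prod ks M X) Z = tensor_inner qs X (modes_prod ks (\<lambda>k. (M k)\<^sup>T) Z)"
  using assms
proof (induction ks arbitrary: X qs)
  case Nil
  then have "ps = qs" by (auto intro: nth_equalityI)
  then show ?case by simp
next
  case (Cons k ks)
  \<comment> \<open>The sizes after the product in mode \<open>k\<close> alone, which the fold
    applies first.\<close>
  let ?qs = "qs[k := ps ! k]"
  have "tensor_inner ps (modes_prod (k # ks) M X) Z =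
      tensor_inner ?qs (mode_prod k (M k) X) (modes_prod ks (\<lambda>k. (M k)\<^sup>T) Z)"
    using Cons.prems by (auto simp: nth_list_update intro!: Cons.IH)
  also have "\<dots> = tensor_inner (?qs[k := qs ! k]) X (mode_prod k ((M k)\<^sup>T) (modes_prod ks (\<lambda>k. (M k)\<^sup>T) Z))"
    using Cons.prems by (intro tensor_inner_mode_prod) auto
  also have "\<dots> = tensor_inner qs X (modes_prod (k # ks) (\<lambda>k. (M k)\<^sup>T) Z)"
    using Cons.prems by (simp add: mode_prod_modes_prod)
  finally show ?case .
qed

section \<open>Contraction as an inner product with slices\<close>

lemma tensor_inner_cong:
  "(\<And>js. js \<in> tensor_indices ps \<Longrightarrow> X js = X' js) \<Longrightarrow> (\<And>js. js \<in> tensor_indices ps \<Longrightarrow> Z js = Z' js) \<Longrightarrow>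
   tensor_inner ps X Z = tensor_inner ps X' Z'"
  by (simp add: tensor_inner_def)

lemma contract_eq_inner: "contract ps A X js = tensor_inner ps A (slice X js)"
  by (simp add: contract_def tensor_inner_def slice_def)

lemma slice_mode_prod:
  "k < length ks \<Longrightarrow> slice (mode_prod k M X) js ks = mode_prod k M (slice X js) ks"
  by (simp add: slice_def mode_prod_def nth_append list_update_append)

text \<open>Only a pointwise identity: \<open>ks\<close> must be long enough to contain all modes in
  \<open>ls\<close>, since otherwise a mode would fall into the part \<open>js\<close>. Updating
  \<open>ks\<close> keeps its length, which carries the induction.\<close>

lemma slice_modes_prod:
  "set ls \<subseteq> {..<length ks} \<Longrightarrow> slice (modes_prod ls M X) js ks = modes_prod ls M (slice X js) ks"
proof (induction ls arbitrary: ks rule: rev_induct)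
  case (snoc k ls)
  have "mode_prod k (M k) (slice (modes_prod ls M X) js) ks =
      mode_prod k (M k) (modes_prod ls M (slice X js)) ks"
    unfolding mode_prod_def using snoc by simp
  with snoc.prems show ?case
    by (simp add: modes_prod_append slice_mode_prod)
qed simp

text \<open>For a fixed response index, the contraction is an inner product with a slice, so the
  matrices pass to \<open>A\<close> by adjointness.\<close>

lemma contract_modes_prod_left:
  assumes "length qs = length ps" "distinct ks" "set ks \<subseteq> {..<length ps}"
    and "\<And>k. k \<in> set ks \<Longrightarrow> M k \<in> carrier_mat (ps ! k) (qs ! k)"
    and "\<And>k. k < length ps \<Longrightarrow> k \<notin> set ks \<Longrightarrow> ps ! k = qs ! k"
  shows "contract ps A (modes_prod ks M X) = contract qs (modes_prod ks (\<lambda>k. (M k)\<^sup>T) A) X"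
proof
  fix js
  have "contract ps A (modes_prod ks M X) js = tensor_inner ps A (modes_prod ks M (slice X js))"
    unfolding contract_eq_inner
    using assms(3) by (intro tensor_inner_cong) (auto simp: slice_modes_prod length_tensor_index)
  also have "\<dots> = tensor_inner qs (modes_prod ks (\<lambda>k. (M k)\<^sup>T) A) (slice X js)"
    using tensor_inner_modes_prod[OF assms(2,3,1,4,5)] by (simp add: tensor_inner_commute)
  finally show "contract ps A (modes_prod ks M X) js = contract qs (modes_prod ks (\<lambda>k. (M k)\<^sup>T) A) X js"
    by (simp add: contract_eq_inner)
qed

lemma contract_mode_prod_left:
  assumes "k < length ps" "M \<in> carrier_mat (ps ! k) b"
  shows "contract ps A (mode_prod k M X) = contract (ps[k := b]) (mode_prod k (M\<^sup>T) A) X"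
  using contract_modes_prod_left[of "ps[k := b]" ps "[k]" "\<lambda>_. M"] assms by simp

text \<open>Mode \<open>l + d\<close> is not summed over, and it becomes mode \<open>l\<close> once
  the first \<open>d\<close> modes are contracted away.\<close>

lemma contract_mode_prod_right:
  assumes "length ps = d"
  shows "contract ps A (mode_prod (l + d) M X) = mode_prod l M (contract ps A X)"
proof
  fix js
  show "contract ps A (mode_prod (l + d) M X) js = mode_prod l M (contract ps A X) js"
    using assms
    by (auto simp: contract_def mode_prod_def length_tensor_index nth_append list_update_append
        sum_distrib_left mult.left_commute intro: sum.swap)
qed

lemma contract_modes_prod_right:
  assumes "length ps = d"
  shows "contract ps A (modes_prod (map (\<lambda>l. l + d) ls) M X) =
    modes_prod ls (\<lambda>l. M (l + d)) (contract ps A X)"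
  using assms by (induction ls arbitrary: X) (auto simp: contract_mode_prod_right)

text \<open>The first \<open>d\<close> matrices are transposed onto \<open>A\<close>; the last
  \<open>m\<close> act on the result of the contraction.\<close>

lemma contract_modes_prod:
  assumes "length ps = d" "length qs = d" "\<And>k. k < d \<Longrightarrow> M k \<in> carrier_mat (ps ! k) (qs ! k)"
  shows "contract ps A (modes_prod [0..<d + m] M X) =
    modes_prod [0..<m] (\<lambda>l. M (l + d)) (contract qs (modes_prod [0..<d] (\<lambda>k. (M k)\<^sup>T) A) X)"
proof -
  have "[0..<d + m] = [0..<d] @ map (\<lambda>l. l + d) [0..<m]"
    using upt_add_eq_append[of 0 d m] by (simp add: map_add_upt add.commute)
  then have "contract ps A (modes_prod [0..<d + m] M X) =
      modes_prod [0..<m] (\<lambda>l. M (l + d)) (contract ps A (modes_prod [0..<d] M X))"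
    by (simp add: modes_prod_append contract_modes_prod_right[OF assms(1)])
  also have "contract ps A (modes_prod [0..<d] M X) = contract qs (modes_prod [0..<d] (\<lambda>k. (M k)\<^sup>T) A) X"
    using assms by (intro contract_modes_prod_left) auto
  finally show ?thesis .
qed

lemma contract_in_tensors:
  assumes "X \<in> tensors (ps @ qs)"
  shows "contract ps A X \<in> tensors qs"
  using assms
  by (auto simp: tensors_def contract_def append_in_tensor_indices_iff length_tensor_index
      intro!: sum.neutral)

lemma contract_add: "contract ps A (X + Z) = contract ps A X + contract ps A Z"
  by (rule ext) (simp add: contract_eq_inner slice_def tensor_inner_def algebra_simps sum.distrib)

lemma contract_sum: "contract ps A (\<Sum>k\<in>K. X k) = (\<Sum>k\<in>K. contract ps A (X k))"
proof (induction K rule: infinite_finite_induct)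
  case empty
  show ?case by (rule ext) (simp add: contract_def)
next
  case (infinite K)
  then show ?case by (intro ext) (simp add: contract_def)
qed (simp only: sum.insert contract_add not_False_eq_True)

section \<open>Matricization\<close>

lemma length_multi_index [simp]: "length (multi_index ps c) = length ps"
  by (induction ps arbitrary: c) auto

lemma matricize_carrier [simp]:
  "matricize ps k X \<in> carrier_mat (ps ! k) (prod_list (take k ps @ drop (Suc k) ps))"
  by (simp add: matricize_def Let_def)

text \<open>The column enumeration leaves out mode \<open>k\<close>, so it is the same before and
  after the product, and the product acts on rows only.\<close>

lemma matricize_mode_prod:
  assumes "M \<in> carrier_mat (ps ! k) b" "k < length ps"
  shows "matricize ps k (mode_prod k M X) = M * matricize (ps[k := b]) k X"
proof (rule eq_matI)
  fix i c
  assume "i < dim_row (M * matricize (ps[k := b]) k X)" "c < dim_col (M * matricize (ps[k := b]) k X)"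
  then have "i < ps ! k" "c < prod_list (take k ps @ drop (Suc k) ps)"
    using assms by (auto simp: matricize_def Let_def)
  then show "matricize ps k (mode_prod k M X) $$ (i, c) = (M * matricize (ps[k := b]) k X) $$ (i, c)"
    using assms
    by (auto simp: matricize_def Let_def mode_prod_def scalar_prod_def list_update_append nth_append
        min_def lessThan_atLeast0 intro!: sum.cong)
qed (use assms in \<open>auto simp: matricize_def Let_def\<close>)

lemma matricize_diff: "matricize ps k (X - Z) = matricize ps k X - matricize ps k Z"
  by (rule eq_matI) (auto simp: matricize_def Let_def)

text \<open>Matricization only rearranges entries and is therefore an isometry.\<close>

lemma mat_inner_matricize:
  assumes "k < length ps"
  shows "mat_inner (matricize ps k X) (matricize ps k Z) = tensor_inner ps X Z"
  unfolding tensor_inner_def sum_tensor_indices_insert[OF assms]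
  by (simp add: sum_multi_index[symmetric] mat_inner_def matricize_def Let_def)

lemma mat_norm_sq: "(mat_norm M)\<^sup>2 = mat_inner M M"
  by (simp add: mat_norm_def mat_inner_def sum_nonneg power2_eq_square)

lemma mat_inner_transpose:
  assumes "M \<in> carrier_mat a b" "N \<in> carrier_mat a b"
  shows "mat_inner (M\<^sup>T) (N\<^sup>T) = mat_inner M N"
  using assms by (auto simp: mat_inner_def intro: sum.swap)

text \<open>Adjointness of right multiplication by \<open>N\<close>; it separates \<open>D k\<close>
  from the slice of \<open>S\<close> in the entrywise form of the core objective.\<close>

lemma mat_inner_mult_transpose:
  assumes "M \<in> carrier_mat a c" "N \<in> carrier_mat b c" "D \<in> carrier_mat a b"
  shows "mat_inner (M * N\<^sup>T) D = mat_inner M (D * N)"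
proof -
  have "mat_inner (M * N\<^sup>T) D = (\<Sum>i<a. \<Sum>j<b. \<Sum>l<c. M $$ (i, l) * N $$ (j, l) * D $$ (i, j))"
    using assms by (auto simp: mat_inner_def scalar_prod_def sum_distrib_right lessThan_atLeast0 intro!: sum.cong)
  also have "\<dots> = (\<Sum>i<a. \<Sum>l<c. \<Sum>j<b. M $$ (i, l) * N $$ (j, l) * D $$ (i, j))"
    by (intro sum.cong refl sum.swap)
  also have "\<dots> = mat_inner M (D * N)"
    using assms by (auto simp: mat_inner_def scalar_prod_def sum_distrib_left lessThan_atLeast0 mult_ac intro!: sum.cong)
  finally show ?thesis .
qed

text \<open>The \<open>r\<close> columns of \<open>N\<close> behind a maximal independent set of columns of \<open>L * N\<close> form an invertible
  matrix.\<close>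

lemma full_rank_left_mult_eq_0:
  fixes D :: "real mat"
  assumes L: "L \<in> carrier_mat p r" and N: "N \<in> carrier_mat r q" and D: "D \<in> carrier_mat s r"
    and rank: "vec_space.rank p (L * N) = r" and DN: "D * N = 0\<^sub>m s q"
  shows "D = 0\<^sub>m s r"
proof -
  interpret vec_space "TYPE(real)" p .
  have LN: "L * N \<in> carrier_mat p q" using L N by simp
  obtain T where T: "maximal T (\<lambda>T. T \<subseteq> set (cols (L * N)) \<and> lin_indpt T)"
    using maximal_exists_superset[of "set (cols (L * N))" "\<lambda>T. T \<subseteq> set (cols (L * N)) \<and> lin_indpt T" "{}"]
      finite_lin_indpt2[of "{}"] by auto
  then have Tsub: "T \<subseteq> set (cols (L * N))" and Tli: "lin_indpt T"
    by (auto simp: maximal_def)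
  have "card T = r" using rank_card_indpt[OF LN T] rank by simp
  moreover have "finite T" using Tsub by (rule finite_subset) simp
  ultimately obtain xs where xs: "set xs = T" "distinct xs" "length xs = r"
    by (metis distinct_card finite_distinct_list)
  have "\<forall>j<r. \<exists>c<q. xs ! j = col (L * N) c"
  proof (intro allI impI)
    fix j assume "j < r"
    then have "xs ! j \<in> set (cols (L * N))" using xs Tsub by auto
    then show "\<exists>c<q. xs ! j = col (L * N) c"
      using N by (auto simp: cols_def)
  qed
  then obtain c where c: "\<And>j. j < r \<Longrightarrow> c j < q \<and> xs ! j = col (L * N) (c j)" by metis
  define N' where "N' = mat r r (\<lambda>(i, j). N $$ (i, c j))"
  have N': "N' \<in> carrier_mat r r" by (simp add: N'_def)
  have colN': "col N' j = col N (c j)" if "j < r" for j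
    using N c[OF that] that by (intro eq_vecI) (auto simp: N'_def)
  have cols: "cols (L * N') = xs"
  proof (rule nth_equalityI)
    show "length (cols (L * N')) = length xs" using N' xs by simp
    fix j assume "j < length (cols (L * N'))"
    then have j: "j < r" using N' by simp
    then show "cols (L * N') ! j = xs ! j"
      using c[OF j] L N N' colN'[OF j] by (simp add: col_mult2[OF L N'] col_mult2[OF L N])
  qed
  have "det N' \<noteq> 0"
  proof
    \<comment> \<open>A kernel vector of \<open>N'\<close> is one of \<open>L * N'\<close>, whose
      columns are the distinct vectors \<open>xs\<close>; this contradicts the independence of
      \<open>T\<close>.\<close>
    assume "det N' = 0"
    then obtain v where v: "v \<in> carrier_vec r" "v \<noteq> 0\<^sub>v r" "N' *\<^sub>v v = 0\<^sub>v r"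
      using det_0_iff_vec_prod_zero_field[OF N'] by blast
    have "(L * N') *\<^sub>v v = 0\<^sub>v p"
      using assoc_mult_mat_vec[OF L N' v(1)] v(3) L
      by (auto intro!: eq_vecI)
    then have "lin_dep (set (cols (L * N')))"
      using L N' v xs by (intro lin_depI[of _ r v]) (auto simp: cols)
    with Tli show False by (simp add: cols xs)
  qed
  then obtain K where K: "K \<in> carrier_mat r r" "N' * K = 1\<^sub>m r"
    using det_non_zero_imp_unit[OF N', of "()"] by (auto simp: Units_def ring_mat_def)
  have "D * N' = 0\<^sub>m s r"
  proof (rule eq_matI)
    fix i j assume ij: "i < dim_row (0\<^sub>m s r)" "j < dim_col (0\<^sub>m s r)"
    then have "(D * N') $$ (i, j) = (D * N) $$ (i, c j)"
      using D N N' c[of j] colN'[of j] by simp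
    then show "(D * N') $$ (i, j) = 0\<^sub>m s r $$ (i, j)"
      using ij c[of j] by (simp add: DN)
  qed (use D N' in auto)
  then have "D * N' * K = 0\<^sub>m s r" using K by simp
  then show ?thesis using assoc_mult_mat[OF D N' K(1)] K(2) D by simp
qed

section \<open>Orthogonal blocks and tangent vectors\<close>

text \<open>The blocks of a tensor space with respect to the splittings \<open>range (U k) \<oplus> range (V k)\<close> that
  matter for tangent vectors: block \<open>k < N\<close> uses \<open>V\<close> in mode \<open>k\<close> and \<open>U\<close> elsewhere, and block \<open>N\<close>
  uses \<open>U\<close> in all modes, since updating position \<open>N\<close> has no effect on the modes below \<open>N\<close>.\<close>

locale orthonormal_frames =
  fixes N :: nat and ps rs :: "nat list" and U V :: "nat \<Rightarrow> real mat"
  assumes length_ps: "length ps = N" and length_rs: "length rs = N"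
    and U_carrier: "\<And>k. k < N \<Longrightarrow> U k \<in> carrier_mat (ps ! k) (rs ! k)"
    and U_orthonormal: "\<And>k. k < N \<Longrightarrow> orthonormal_columns (U k)"
    and V_complement: "\<And>k. k < N \<Longrightarrow> orthonormal_complement (U k) (V k)"
begin

definition block_dims :: "nat \<Rightarrow> nat list" where
  "block_dims k = rs[k := ps ! k - rs ! k]"

definition embed :: "nat \<Rightarrow> tensor \<Rightarrow> tensor" where
  "embed k E = modes_prod [0..<N] (U(k := V k)) E"

text \<open>The adjoint of \<open>embed k\<close>: it yields the coordinates of \<open>Z\<close> in
  block \<open>k\<close>, of size \<open>block_dims k\<close>, and not the component inside the
  ambient space.\<close>

definition block :: "nat \<Rightarrow> tensor \<Rightarrow> tensor" where
  "block k Z = modes_prod [0..<N] (\<lambda>j. ((U(k := V k)) j)\<^sup>T) Z"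

lemma V_carrier: "k < N \<Longrightarrow> V k \<in> carrier_mat (ps ! k) (ps ! k - rs ! k)"
  using V_complement[of k] U_carrier[of k] by (auto simp: orthonormal_complement_def)

lemma frame_carrier: "j < N \<Longrightarrow> (U(k := V k)) j \<in> carrier_mat (ps ! j) (block_dims k ! j)"
  using U_carrier V_carrier by (auto simp: block_dims_def length_rs)

lemma length_block_dims: "length (block_dims k) = N"
  by (simp add: block_dims_def length_rs)

lemma block_dims_last: "block_dims N = rs"
  by (simp add: block_dims_def length_rs list_update_beyond)

lemma block_last: "block N Z = modes_prod [0..<N] (\<lambda>j. (U j)\<^sup>T) Z"
  unfolding block_def by (rule modes_prod_cong) auto

lemma frame_gram_self: "j < N \<Longrightarrow> ((U(k := V k)) j)\<^sup>T * (U(k := V k)) j = 1\<^sub>m (block_dims k ! j)"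
  using U_orthonormal[of j] V_complement[of j] U_carrier[of j] V_carrier[of j]
  by (auto simp: block_dims_def length_rs orthonormal_columns_def orthonormal_complement_def)

lemma U_V_orthogonal: "k < N \<Longrightarrow> (U k)\<^sup>T * V k = 0\<^sub>m (rs ! k) (ps ! k - rs ! k)"
  using V_complement[of k] U_carrier[of k] V_carrier[of k] by (auto simp: orthonormal_complement_def)

lemma V_U_orthogonal:
  assumes "k < N"
  shows "(V k)\<^sup>T * U k = 0\<^sub>m (ps ! k - rs ! k) (rs ! k)"
proof -
  have "(V k)\<^sup>T * U k = ((U k)\<^sup>T * V k)\<^sup>T"
    using U_carrier[OF assms] V_carrier[OF assms] by (subst transpose_mult) auto
  then show ?thesis by (simp add: U_V_orthogonal[OF assms])
qed

text \<open>Of two different block numbers at least one is below \<open>N\<close>; in that mode one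
  frame uses \<open>V\<close> and the other \<open>U\<close>, and these are orthogonal.\<close>

lemma frame_gram_other:
  assumes "k \<le> N" "l \<le> N" "k \<noteq> l"
  shows "\<exists>j<N. \<exists>a b. ((U(k := V k)) j)\<^sup>T * (U(l := V l)) j = 0\<^sub>m a b"
proof (cases "k < N")
  case True
  then have "((U(k := V k)) k)\<^sup>T * (U(l := V l)) k = 0\<^sub>m (ps ! k - rs ! k) (rs ! k)"
    using assms V_U_orthogonal by simp
  with True show ?thesis by blast
next
  case False
  then have "l < N" using assms by simp
  moreover have "((U(k := V k)) l)\<^sup>T * (U(l := V l)) l = 0\<^sub>m (rs ! l) (ps ! l - rs ! l)"
    using assms U_V_orthogonal[OF \<open>l < N\<close>] by simp
  ultimately show ?thesis by blast
qed

text \<open>Mode by mode the composition multiplies by Gram matrices. These are all identities if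
  the blocks agree; otherwise one of them vanishes and annihilates the whole product.\<close>

lemma block_embed:
  assumes "k \<le> N" "l \<le> N" "E \<in> tensors (block_dims l)"
  shows "block k (embed l E) = (if k = l then E else 0)"
proof -
  have "block k (embed l E) = modes_prod [0..<N] (\<lambda>j. ((U(k := V k)) j)\<^sup>T * (U(l := V l)) j) E"
    unfolding block_def embed_def
  proof (rule modes_prod_modes_prod)
    fix j assume "j \<in> set [0..<N]"
    then show "dim_col (((U(k := V k)) j)\<^sup>T) = dim_row ((U(l := V l)) j)"
      using frame_carrier[of j k] frame_carrier[of j l] by simp
  qed simp
  also have "\<dots> = (if k = l then E else 0)"
  proof (cases "k = l")
    case True
    then show ?thesis
      using assms(3) frame_gram_self[of _ l] length_block_dims by (auto intro!: modes_prod_one)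
  next
    case False
    then show ?thesis
      using frame_gram_other[OF assms(1,2)] by (auto intro!: modes_prod_zero_mat)
  qed
  finally show ?thesis .
qed

lemma embed_in_tensors:
  assumes "E \<in> tensors (block_dims k)"
  shows "embed k E \<in> tensors ps"
  unfolding embed_def
proof (rule modes_prod_in_tensors[OF assms])
  fix j assume "j < length (block_dims k)"
  then show "ps ! j = (if j \<in> set [0..<N] then dim_row ((U(k := V k)) j) else block_dims k ! j)"
    using frame_carrier[of j k] by (simp add: length_block_dims)
qed (auto simp: length_block_dims length_ps)

lemma tensor_inner_embed:
  "tensor_inner ps Z (embed k E) = tensor_inner (block_dims k) (block k Z) E"
proof -
  have "tensor_inner ps (embed k E) Z = tensor_inner (block_dims k) E (block k Z)"
    unfolding embed_def block_def
    using frame_carrier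
    by (intro tensor_inner_modes_prod) (auto simp: length_block_dims length_ps)
  then show ?thesis by (simp only: tensor_inner_commute)
qed

lemma block_sum_embed:
  assumes "\<And>k. k \<le> N \<Longrightarrow> E k \<in> tensors (block_dims k)" "k \<le> N"
  shows "block k (\<Sum>l\<le>N. embed l (E l)) = E k"
proof -
  have "block k (\<Sum>l\<le>N. embed l (E l)) = (\<Sum>l\<le>N. block k (embed l (E l)))"
    unfolding block_def by (rule modes_prod_sum)
  also have "\<dots> = (\<Sum>l\<le>N. if l = k then E k else 0)"
    using assms by (intro sum.cong refl) (simp add: block_embed)
  also have "\<dots> = E k" using assms(2) by (simp only: sum.delta finite_atMost atMost_iff if_True)
  finally show ?thesis .
qed

text \<open>Pythagoras: by adjointness and \<open>block_embed\<close> both the cross term and the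
  norm of the sum split over the blocks, and the square is completed in each block. The first two
  terms do not depend on \<open>E\<close>.\<close>

lemma norm_sq_diff_sum_embed:
  assumes E: "\<And>k. k \<le> N \<Longrightarrow> E k \<in> tensors (block_dims k)"
  shows "(tensor_norm ps (Z - (\<Sum>k\<le>N. embed k (E k))))\<^sup>2 =
    (tensor_norm ps Z)\<^sup>2 - (\<Sum>k\<le>N. (tensor_norm (block_dims k) (block k Z))\<^sup>2)
    + (\<Sum>k\<le>N. (tensor_norm (block_dims k) (block k Z - E k))\<^sup>2)"
proof -
  let ?W = "\<Sum>k\<le>N. embed k (E k)"
  have inner: "tensor_inner ps Z' ?W = (\<Sum>k\<le>N. tensor_inner (block_dims k) (block k Z') (E k))" for Z'
    by (simp only: tensor_inner_sum_right tensor_inner_embed)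
  have "tensor_inner ps ?W ?W = (\<Sum>k\<le>N. tensor_inner (block_dims k) (E k) (E k))"
    unfolding inner using E by (intro sum.cong refl) (simp add: block_sum_embed)
  moreover have "tensor_inner ps (Z - ?W) (Z - ?W) =
      tensor_inner ps Z Z - 2 * tensor_inner ps Z ?W + tensor_inner ps ?W ?W"
    unfolding tensor_inner_diff_left tensor_inner_diff_right
    using tensor_inner_commute[of ps ?W Z] by simp
  moreover have "tensor_inner qs (R - F) (R - F) =
      tensor_inner qs R R - 2 * tensor_inner qs R F + tensor_inner qs F F" for qs R F
    unfolding tensor_inner_diff_left tensor_inner_diff_right
    using tensor_inner_commute[of qs F R] by simp
  ultimately show ?thesis
    unfolding tensor_norm_sq
    by (simp add: inner sum.distrib sum_subtractf sum_distrib_left)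
qed

section \<open>Tangent vectors in block coordinates\<close>

definition tangent_blocks :: "tensor \<Rightarrow> tensor \<Rightarrow> (nat \<Rightarrow> real mat) \<Rightarrow> nat \<Rightarrow> tensor" where
  "tangent_blocks S B D k = (if k = N then B else mode_prod k (D k) S)"

lemma tangent_blocks_in_tensors:
  assumes "S \<in> tensors rs" "B \<in> tensors rs"
    and "\<forall>k<N. D k \<in> carrier_mat (ps ! k - rs ! k) (rs ! k)" "k \<le> N"
  shows "tangent_blocks S B D k \<in> tensors (block_dims k)"
proof (cases "k = N")
  case True
  with assms show ?thesis by (simp add: tangent_blocks_def block_dims_last)
next
  case False
  then show ?thesis
    using assms(1,4) assms(3)[rule_format, of k]
    by (simp add: tangent_blocks_def block_dims_def length_rs mode_prod_in_tensors)
qed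

text \<open>The factor \<open>V k * D k\<close> is split: \<open>D k\<close> acts on
  \<open>S\<close> and forms the block, while \<open>V k\<close> joins the frame.\<close>

lemma tangent_vector_eq_sum_embed:
  assumes "\<forall>k<N. D k \<in> carrier_mat (ps ! k - rs ! k) (rs ! k)"
  shows "tangent_vector N S U V B D = (\<Sum>k\<le>N. embed k (tangent_blocks S B D k))"
proof -
  have "modes_prod (other_modes N k) U (mode_prod k (V k * D k) S) = embed k (tangent_blocks S B D k)"
    if "k < N" for k
    using that V_carrier[OF that] assms[rule_format, OF that]
    by (simp add: modes_prod_other_modes embed_def tangent_blocks_def
        mode_prod_mode_prod[symmetric] flip: modes_prod_other_modes)
  moreover have "modes_prod [0..<N] U B = embed N (tangent_blocks S B D N)"
    by (auto simp: embed_def tangent_blocks_def intro: modes_prod_cong)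
  ultimately show ?thesis
    by (simp add: tangent_vector_def lessThan_Suc_atMost[symmetric] add.commute)
qed

lemma tangent_vector_in_tensors:
  assumes "S \<in> tensors rs" "B \<in> tensors rs"
    and "\<forall>k<N. D k \<in> carrier_mat (ps ! k - rs ! k) (rs ! k)"
  shows "tangent_vector N S U V B D \<in> tensors ps"
  unfolding tangent_vector_eq_sum_embed[OF assms(3)]
  using tangent_blocks_in_tensors[OF assms] by (intro tensors_sum embed_in_tensors) simp

text \<open>For fixed \<open>S\<close>, tangent vectors are linear in \<open>(B, D)\<close>; hence
  the tangent space is closed under differences.\<close>

lemma tangent_vector_diff:
  assumes "\<forall>k<N. D k \<in> carrier_mat (ps ! k - rs ! k) (rs ! k)"
    and "\<forall>k<N. D' k \<in> carrier_mat (ps ! k - rs ! k) (rs ! k)"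
  shows "tangent_vector N S U V B D - tangent_vector N S U V B' D' =
    tangent_vector N S U V (B - B') (\<lambda>k. D k - D' k)"
proof -
  have "embed k (tangent_blocks S B D k) - embed k (tangent_blocks S B' D' k) =
      embed k (tangent_blocks S (B - B') (\<lambda>k. D k - D' k) k)" if "k \<le> N" for k
    using that assms(1)[rule_format, of k] assms(2)[rule_format, of k]
    by (auto simp: embed_def tangent_blocks_def mode_prod_diff_mat simp flip: modes_prod_diff)
  moreover have "tangent_vector N S U V (B - B') (\<lambda>k. D k - D' k) =
      (\<Sum>k\<le>N. embed k (tangent_blocks S (B - B') (\<lambda>k. D k - D' k) k))"
    by (rule tangent_vector_eq_sum_embed) (use assms in \<open>auto simp: minus_carrier_mat\<close>)
  ultimately show ?thesis
    using assms by (simp add: tangent_vector_eq_sum_embed sum_subtractf[symmetric])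
qed

text \<open>Removes the projector from the objective. \<open>Z\<close> meets the defining condition,
  and any other \<open>Z'\<close> that does leaves a difference which lies in the tangent space and
  is orthogonal to itself.\<close>

lemma orth_projector_tangent_space:
  assumes S: "S \<in> tensors rs" and Z: "Z \<in> tangent_space ps rs S U V"
  shows "orth_projector ps (tangent_space ps rs S U V) Z = Z"
  unfolding orth_projector_def
proof (rule the_equality)
  show "Z \<in> tangent_space ps rs S U V \<and> (\<forall>W\<in>tangent_space ps rs S U V. tensor_inner ps (Z - Z) W = 0)"
    using Z by (simp add: tensor_inner_def)
next
  fix Z'
  assume Z': "Z' \<in> tangent_space ps rs S U V \<and> (\<forall>W\<in>tangent_space ps rs S U V. tensor_inner ps (Z - Z') W = 0)"
  obtain B D where BD: "Z = tangent_vector N S U V B D" "B \<in> tensors rs"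
    "\<forall>k<N. D k \<in> carrier_mat (ps ! k - rs ! k) (rs ! k)"
    using Z by (auto simp: tangent_space_def length_ps)
  obtain B' D' where BD': "Z' = tangent_vector N S U V B' D'" "B' \<in> tensors rs"
    "\<forall>k<N. D' k \<in> carrier_mat (ps ! k - rs ! k) (rs ! k)"
    using Z' by (auto simp: tangent_space_def length_ps)
  have diff: "Z - Z' = tangent_vector N S U V (B - B') (\<lambda>k. D k - D' k)"
    using BD BD' by (simp add: tangent_vector_diff)
  have carr: "D k - D' k \<in> carrier_mat (ps ! k - rs ! k) (rs ! k)" if "k < N" for k
    using BD(3) BD'(3) that by (simp add: minus_carrier_mat)
  have "Z - Z' \<in> tangent_space ps rs S U V"
    unfolding tangent_space_def length_ps using diff carr tensors_diff[OF BD(2) BD'(2)] by blast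
  then have "tensor_inner ps (Z - Z') (Z - Z') = 0" using Z' by blast
  moreover have "Z - Z' \<in> tensors ps"
    unfolding diff using S tensors_diff[OF BD(2) BD'(2)] carr by (intro tangent_vector_in_tensors) auto
  ultimately have "Z - Z' = 0" by (intro tensor_inner_self_eq_0)
  then show "Z' = Z" by (simp only: right_minus_eq)
qed

text \<open>Applying \<open>block k\<close> recovers every block. Block \<open>N\<close> is the core
  itself; for \<open>k < N\<close> the block determines \<open>D k\<close> because of the rank
  condition.\<close>

lemma tangent_vector_inject:
  assumes "S \<in> tensors rs" "B \<in> tensors rs" "B' \<in> tensors rs"
    and D: "\<forall>k<N. D k \<in> carrier_mat (ps ! k - rs ! k) (rs ! k)"
    and D': "\<forall>k<N. D' k \<in> carrier_mat (ps ! k - rs ! k) (rs ! k)"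
    and rank: "tucker_rank ps (modes_prod [0..<N] U S) = rs"
    and eq: "tangent_vector N S U V B D = tangent_vector N S U V B' D'"
  shows "B = B'" "\<And>k. k < N \<Longrightarrow> D k = D' k"
proof -
  have blocks: "tangent_blocks S B D k = tangent_blocks S B' D' k" if "k \<le> N" for k
  proof -
    have "tangent_blocks S B D k = block k (tangent_vector N S U V B D)"
      unfolding tangent_vector_eq_sum_embed[OF D]
      using tangent_blocks_in_tensors[OF assms(1,2) D] that by (simp add: block_sum_embed)
    also have "\<dots> = tangent_blocks S B' D' k"
      unfolding eq tangent_vector_eq_sum_embed[OF D']
      using tangent_blocks_in_tensors[OF assms(1,3) D'] that by (simp add: block_sum_embed)
    finally show ?thesis .
  qed
  from blocks[of N] show "B = B'" by (simp add: tangent_blocks_def)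
  fix k assume k: "k < N"
  have Dk: "D k \<in> carrier_mat (ps ! k - rs ! k) (rs ! k)"
    and Dk': "D' k \<in> carrier_mat (ps ! k - rs ! k) (rs ! k)" using D D' k by auto
  \<comment> \<open>The core multiplied in all modes but \<open>k\<close>. The mode-\<open>k\<close>
    matricization of the full product is \<open>U k\<close> times that of \<open>?R\<close>, so the
    rank hypothesis applies to this factorization directly.\<close>
  let ?R = "modes_prod (other_modes N k) U S"
  let ?ps = "ps[k := rs ! k]"
  have "modes_prod [0..<N] U S = modes_prod (other_modes N k) U (mode_prod k (U k) S)"
    by (simp add: modes_prod_other_modes[OF k])
  also have "\<dots> = mode_prod k (U k) ?R"
    by (simp add: mode_prod_modes_prod other_modes_def)
  finally have "matricize ps k (modes_prod [0..<N] U S) = U k * matricize ?ps k ?R"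
    using matricize_mode_prod[of "U k" ps k "rs ! k"] U_carrier[OF k] k by (simp add: length_ps)
  moreover have "vec_space.rank (ps ! k) (matricize ps k (modes_prod [0..<N] U S)) = rs ! k"
    using arg_cong[OF rank, of "\<lambda>xs. xs ! k"] k by (simp add: tucker_rank_def length_ps)
  ultimately have rk: "vec_space.rank (ps ! k) (U k * matricize ?ps k ?R) = rs ! k" by simp
  have carr: "matricize ?ps k ?R \<in> carrier_mat (rs ! k) (prod_list (take k ?ps @ drop (Suc k) ?ps))"
    using matricize_carrier[of ?ps k ?R] k by (simp add: length_ps)
  have DD': "D k - D' k \<in> carrier_mat (ps ! k - rs ! k) (rs ! k)"
    using Dk Dk' by (simp add: minus_carrier_mat)
  \<comment> \<open>The vanishing carries over from \<open>S\<close> to \<open>?R\<close> because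
    the other modes commute with mode \<open>k\<close>; matricizing then gives a vanishing product
    of matrices.\<close>
  have "mode_prod k (D k - D' k) S = 0"
    using blocks[of k] k mode_prod_diff_mat[OF Dk Dk'] by (simp add: tangent_blocks_def)
  then have "mode_prod k (D k - D' k) ?R = 0"
    by (simp only: mode_prod_modes_prod other_modes_def set_filter mem_Collect_eq modes_prod_zero
        not_True_eq_False simp_thms)
  moreover have "matricize (?ps[k := ps ! k - rs ! k]) k (mode_prod k (D k - D' k) ?R) =
      (D k - D' k) * matricize ?ps k ?R"
    using DD' k by (subst matricize_mode_prod[where b = "rs ! k"]) (auto simp: length_ps)
  ultimately have "(D k - D' k) * matricize ?ps k ?R = matricize (?ps[k := ps ! k - rs ! k]) k 0"
    by simp
  also have "\<dots> = 0\<^sub>m (ps ! k - rs ! k) (prod_list (take k ?ps @ drop (Suc k) ?ps))"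
    using k by (intro eq_matI) (auto simp: matricize_def Let_def length_ps)
  finally have "D k - D' k = 0\<^sub>m (ps ! k - rs ! k) (rs ! k)"
    by (rule full_rank_left_mult_eq_0[OF U_carrier[OF k] carr DD' rk])
  then show "D k = D' k"
    using Dk Dk' by (auto simp: mat_eq_iff)
qed

end

section \<open>Decoupling of the residual\<close>

lemma stack_diff: "stack n Z - stack n W = stack n (\<lambda>i. Z i - W i)"
  by (rule ext) (simp add: stack_def split: list.split)

lemma tensor_norm_sq_stack:
  "(tensor_norm (n # qs) (stack n Z))\<^sup>2 = (\<Sum>i<n. (tensor_norm qs (Z i))\<^sup>2)"
  by (simp add: tensor_norm_sq tensor_inner_def sum_tensor_indices_Cons stack_def)

lemma transpose_fun_upd: "(\<lambda>j. ((U(k := W)) j)\<^sup>T) = (\<lambda>j. (U j)\<^sup>T)(k := W\<^sup>T)"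
  by auto

locale tucker_regression =
  fixes d m :: nat and ps rs :: "nat list" and S :: tensor and U V :: "nat \<Rightarrow> real mat"
  assumes frames: "orthonormal_frames (d + m) ps rs U V" and S_tensor: "S \<in> tensors rs"
begin

sublocale orthonormal_frames "d + m" ps rs U V
  by (rule frames)

text \<open>The same frames on the last \<open>m\<close> modes, renumbered from 0. Responses and
  contracted tangent vectors are split into blocks here.\<close>

sublocale response: orthonormal_frames m "drop d ps" "drop d rs" "\<lambda>l. U (l + d)" "\<lambda>l. V (l + d)"
  using U_carrier U_orthonormal V_complement
  by unfold_locales (auto simp: length_ps length_rs add.commute)

text \<open>The core of the contracted tangent vector; it sees \<open>D k\<close> for
  \<open>k < d\<close> only.\<close>

definition core_fit :: "tensor \<Rightarrow> tensor \<Rightarrow> (nat \<Rightarrow> real mat) \<Rightarrow> tensor" where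
  "core_fit A B D = contract (take d rs) (core_covariate d U A) B
     + (\<Sum>k<d. contract ((take d rs)[k := ps ! k - rs ! k])
          (modes_prod (other_modes d k) (\<lambda>j. (U j)\<^sup>T) (mode_prod k ((V k)\<^sup>T) A))
          (mode_prod k (D k) S))"

lemma core_residual_eq:
  "core_residual d m ps rs S U V A Y B D = core_response d m U Y - core_fit A B D"
  unfolding core_residual_def core_fit_def by (simp only: diff_diff_eq)

text \<open>Takes the place of \<open>S\<close> in the contracted tangent vector.\<close>

definition mode_core :: "tensor \<Rightarrow> tensor" where
  "mode_core A = contract (take d rs) (core_covariate d U A) S"

lemma take_rs_update: "k < d \<Longrightarrow> (take d rs)[k := rs ! k] = take d rs"
  using list_update_id[of "take d rs" k] by simp

lemma drop_rs_update: "l < m \<Longrightarrow> (drop d rs)[l := rs ! (l + d)] = drop d rs"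
  using list_update_id[of "drop d rs" l] by (simp add: length_rs add.commute)

lemma mode_core_in_tensors: "mode_core A \<in> tensors (drop d rs)"
  unfolding mode_core_def using S_tensor by (intro contract_in_tensors) simp

lemma core_fit_in_tensors:
  assumes "B \<in> tensors rs" "\<forall>k<d. D k \<in> carrier_mat (ps ! k - rs ! k) (rs ! k)"
  shows "core_fit A B D \<in> tensors (drop d rs)"
proof -
  have "mode_prod k (D k) S \<in> tensors ((take d rs)[k := ps ! k - rs ! k] @ drop d rs)" if "k < d" for k
  proof -
    have "mode_prod k (D k) S \<in> tensors (rs[k := ps ! k - rs ! k])"
      using S_tensor assms(2)[rule_format, OF that] that
      by (intro mode_prod_in_tensors) (auto simp: length_rs)
    also have "rs[k := ps ! k - rs ! k] = (take d rs @ drop d rs)[k := ps ! k - rs ! k]" by simp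
    also have "\<dots> = (take d rs)[k := ps ! k - rs ! k] @ drop d rs"
      using that by (subst list_update_append1) (auto simp: length_rs)
    finally show ?thesis .
  qed
  then show ?thesis
    unfolding core_fit_def using assms(1)
    by (intro tensors_add tensors_sum contract_in_tensors) auto
qed

lemma contract_frame:
  assumes "\<And>k. k < d \<Longrightarrow> W k \<in> carrier_mat (ps ! k) (rs ! k)"
  shows "contract (take d ps) A (modes_prod [0..<d + m] W X) =
    modes_prod [0..<m] (\<lambda>l. W (l + d)) (contract (take d rs) (modes_prod [0..<d] (\<lambda>k. (W k)\<^sup>T) A) X)"
  using assms by (intro contract_modes_prod) (auto simp: length_ps length_rs)

text \<open>A term with \<open>k < d\<close> has plain \<open>U\<close> factors in all response
  modes and so merges into the core. A term \<open>l + d\<close> keeps its factor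
  \<open>V (l + d) * D (l + d)\<close> and stays a tangent direction, now at the core
  \<open>mode_core A\<close>.\<close>

lemma contract_tangent_vector:
  assumes D: "\<forall>k<d + m. D k \<in> carrier_mat (ps ! k - rs ! k) (rs ! k)"
  shows "contract (take d ps) A (tangent_vector (d + m) S U V B D) =
    tangent_vector m (mode_core A) (\<lambda>l. U (l + d)) (\<lambda>l. V (l + d)) (core_fit A B D) (\<lambda>l. D (l + d))"
proof -
  let ?U = "\<lambda>l. U (l + d)" and ?V = "\<lambda>l. V (l + d)"
  let ?t = "\<lambda>k. contract (take d ps) A (modes_prod (other_modes (d + m) k) U (mode_prod k (V k * D k) S))"
  have core: "contract (take d ps) A (modes_prod [0..<d + m] U B) =
      modes_prod [0..<m] ?U (contract (take d rs) (core_covariate d U A) B)"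
    unfolding core_covariate_def using U_carrier by (intro contract_frame) auto
  have left: "?t k = modes_prod [0..<m] ?U (contract ((take d rs)[k := ps ! k - rs ! k])
          (modes_prod (other_modes d k) (\<lambda>j. (U j)\<^sup>T) (mode_prod k ((V k)\<^sup>T) A))
          (mode_prod k (D k) S))" if k: "k < d" for k
  proof -
    have Dk: "D k \<in> carrier_mat (ps ! k - rs ! k) (rs ! k)" and Vk: "V k \<in> carrier_mat (ps ! k) (ps ! k - rs ! k)"
      using D V_carrier[of k] k by auto
    let ?A = "mode_prod k ((V k)\<^sup>T) A"
    have "?t k = contract (take d ps) A (modes_prod [0..<d + m] (U(k := V k * D k)) S)"
      using k by (simp add: modes_prod_other_modes)
    also have "\<dots> = modes_prod [0..<m] (\<lambda>l. (U(k := V k * D k)) (l + d))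
        (contract (take d rs) (modes_prod [0..<d] (\<lambda>j. ((U(k := V k * D k)) j)\<^sup>T) A) S)"
      using Dk Vk U_carrier by (intro contract_frame) auto
    also have "(\<lambda>l. (U(k := V k * D k)) (l + d)) = ?U"
      using k by auto
    also have "modes_prod [0..<d] (\<lambda>j. ((U(k := V k * D k)) j)\<^sup>T) A =
        modes_prod (other_modes d k) (\<lambda>j. (U j)\<^sup>T) (mode_prod k ((V k * D k)\<^sup>T) A)"
      using k by (simp only: transpose_fun_upd modes_prod_other_modes)
    \<comment> \<open>The two factors part here: \<open>V k\<close> stays with \<open>A\<close>,
      while \<open>D k\<close> is moved back to \<open>S\<close> by adjointness, which produces the
      covariates of the core problem.\<close>
    also have "mode_prod k ((V k * D k)\<^sup>T) A = mode_prod k ((D k)\<^sup>T) ?A"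
      using Dk Vk by (simp add: mode_prod_mode_prod transpose_mult[OF Vk Dk])
    also have "modes_prod (other_modes d k) (\<lambda>j. (U j)\<^sup>T) (mode_prod k ((D k)\<^sup>T) ?A) =
        mode_prod k ((D k)\<^sup>T) (modes_prod (other_modes d k) (\<lambda>j. (U j)\<^sup>T) ?A)"
      by (simp add: mode_prod_modes_prod other_modes_def)
    also have "contract (take d rs) \<dots> S =
        contract ((take d rs)[k := ps ! k - rs ! k]) (modes_prod (other_modes d k) (\<lambda>j. (U j)\<^sup>T) ?A) (mode_prod k (D k) S)"
      using contract_mode_prod_left[of k "(take d rs)[k := ps ! k - rs ! k]" "D k" "rs ! k"] Dk k
      by (simp add: length_rs take_rs_update)
    finally show ?thesis .
  qed
  have right: "?t (l + d) = modes_prod (other_modes m l) ?U (mode_prod l (?V l * D (l + d)) (mode_core A))"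
    if l: "l < m" for l
  proof -
    have "?t (l + d) = contract (take d ps) A (modes_prod [0..<d + m] (U(l + d := ?V l * D (l + d))) S)"
      using l by (simp add: modes_prod_other_modes)
    also have "\<dots> = modes_prod [0..<m] (\<lambda>j. (U(l + d := ?V l * D (l + d))) (j + d))
        (contract (take d rs) (modes_prod [0..<d] (\<lambda>j. ((U(l + d := ?V l * D (l + d))) j)\<^sup>T) A) S)"
      using U_carrier by (intro contract_frame) auto
    also have "modes_prod [0..<d] (\<lambda>j. ((U(l + d := ?V l * D (l + d))) j)\<^sup>T) A = core_covariate d U A"
      unfolding core_covariate_def by (rule modes_prod_cong) auto
    also have "(\<lambda>j. (U(l + d := ?V l * D (l + d))) (j + d)) = ?U(l := ?V l * D (l + d))"
      by auto
    finally show ?thesis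
      by (simp only: modes_prod_other_modes[OF l] mode_core_def)
  qed
  have "(\<Sum>k<d + m. ?t k) = (\<Sum>k<d. ?t k) + (\<Sum>l<m. ?t (l + d))"
    using sum.atLeastLessThan_concat[of 0 d "d + m" ?t] sum.shift_bounds_nat_ivl[of ?t 0 d m]
    by (simp only: lessThan_atLeast0 add_0 add.commute[of m d] le_add1 zero_le)
  also have "\<dots> = modes_prod [0..<m] ?U (\<Sum>k<d. contract ((take d rs)[k := ps ! k - rs ! k])
          (modes_prod (other_modes d k) (\<lambda>j. (U j)\<^sup>T) (mode_prod k ((V k)\<^sup>T) A)) (mode_prod k (D k) S))
      + (\<Sum>l<m. modes_prod (other_modes m l) ?U (mode_prod l (?V l * D (l + d)) (mode_core A)))"
    unfolding modes_prod_sum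
    by (intro arg_cong2[of _ _ _ _ "(+)"] sum.cong refl left right) auto
  finally show ?thesis
    unfolding tangent_vector_def core_fit_def contract_add contract_sum core modes_prod_add
    by (simp only: add.assoc)
qed

section \<open>Residuals of the response modes and the splitting of the objective\<close>

definition mode_residual_sq :: "tensor \<Rightarrow> tensor \<Rightarrow> nat \<Rightarrow> real mat \<Rightarrow> real" where
  "mode_residual_sq A Y k E =
     (mat_norm (mode_response d m ps rs U V Y k - mode_covariate d rs S U A k * E))\<^sup>2"

lemma core_response_eq_block: "core_response d m U Y = response.block m Y"
  by (simp add: core_response_def response.block_last)

lemma mode_covariate_carrier:
  assumes "l < m"
  shows "mode_covariate d rs S U A (l + d)
    \<in> carrier_mat (prod_list (take l (drop d rs) @ drop (Suc l) (drop d rs))) (rs ! (l + d))"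
  using matricize_carrier[of "drop d rs" l] assms
  by (simp add: mode_covariate_def length_rs add.commute)

lemma mode_response_carrier:
  assumes "l < m"
  shows "mode_response d m ps rs U V Y (l + d)
    \<in> carrier_mat (prod_list (take l (drop d rs) @ drop (Suc l) (drop d rs))) (ps ! (l + d) - rs ! (l + d))"
proof -
  have "V (l + d) \<in> carrier_mat (ps ! (l + d)) (ps ! (l + d) - rs ! (l + d))"
    using V_carrier assms by simp
  then show ?thesis
    using matricize_carrier[of "(drop d rs)[l := ps ! (l + d)]" l] assms
    by (auto simp: mode_response_def length_rs intro!: mult_carrier_mat)
qed

text \<open>Matricizing turns the products by the transpose of \<open>V (l + d)\<close> and by
  \<open>D\<close> into left multiplications. Transposing makes them right multiplications, which is
  why the unknown of the mode problem is the transpose of \<open>D\<close>.\<close>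

lemma mode_residual_eq_matricize:
  assumes l: "l < m" and D: "D \<in> carrier_mat (ps ! (l + d) - rs ! (l + d)) (rs ! (l + d))"
  shows "mode_response d m ps rs U V Y (l + d) - mode_covariate d rs S U A (l + d) * D\<^sup>T =
    (matricize (response.block_dims l) l (response.block l Y - mode_prod l D (mode_core A)))\<^sup>T"
proof -
  let ?V = "V (l + d)" and ?q = "response.block_dims l"
  let ?Y = "modes_prod (other_modes m l) (\<lambda>j. (U (j + d))\<^sup>T) Y"
  let ?c = "prod_list (take l (drop d rs) @ drop (Suc l) (drop d rs))"
  have V: "?V \<in> carrier_mat (ps ! (l + d)) (ps ! (l + d) - rs ! (l + d))"
    using V_carrier l by simp
  have q: "?q = (drop d rs)[l := ps ! (l + d) - rs ! (l + d)]"
    using l by (simp add: response.block_dims_def length_ps length_rs add.commute)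
  have "response.block l Y = modes_prod (other_modes m l) (\<lambda>j. (U (j + d))\<^sup>T) (mode_prod l (?V\<^sup>T) Y)"
    unfolding response.block_def using l by (simp only: transpose_fun_upd modes_prod_other_modes)
  also have "\<dots> = mode_prod l (?V\<^sup>T) ?Y"
    by (simp add: mode_prod_modes_prod other_modes_def)
  finally have "matricize ?q l (response.block l Y) = ?V\<^sup>T * matricize ((drop d rs)[l := ps ! (l + d)]) l ?Y"
    using V l by (simp add: q matricize_mode_prod[where b = "ps ! (l + d)"] length_rs)
  then have "(matricize ?q l (response.block l Y))\<^sup>T = mode_response d m ps rs U V Y (l + d)"
    using V matricize_carrier[of "(drop d rs)[l := ps ! (l + d)]" l ?Y] l
    by (simp add: transpose_mult[where n = "ps ! (l + d)" and nc = ?c] mode_response_def length_rs)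
  moreover have "matricize ?q l (mode_prod l D (mode_core A)) = D * matricize (drop d rs) l (mode_core A)"
    using D l by (simp add: q matricize_mode_prod[where b = "rs ! (l + d)"] length_rs drop_rs_update)
  then have "(matricize ?q l (mode_prod l D (mode_core A)))\<^sup>T = mode_covariate d rs S U A (l + d) * D\<^sup>T"
    using D matricize_carrier[of "drop d rs" l "mode_core A"] l
    by (simp add: transpose_mult[where n = "rs ! (l + d)" and nc = ?c] mode_covariate_def mode_core_def length_rs add.commute)
  ultimately show ?thesis
    unfolding matricize_diff
    using transpose_minus[OF matricize_carrier matricize_carrier] by metis
qed

lemma mode_residual_sq_eq:
  assumes "l < m" "D \<in> carrier_mat (ps ! (l + d) - rs ! (l + d)) (rs ! (l + d))"
  shows "mode_residual_sq A Y (l + d) (D\<^sup>T) =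
    (tensor_norm (response.block_dims l) (response.block l Y - mode_prod l D (mode_core A)))\<^sup>2"
  unfolding mode_residual_sq_def mode_residual_eq_matricize[OF assms] mat_norm_sq tensor_norm_sq
    mat_inner_transpose[OF matricize_carrier matricize_carrier]
  using assms by (intro mat_inner_matricize) (simp add: response.length_block_dims)

text \<open>Pythagoras in the response space, for one sample. Block \<open>m\<close> yields the core
  residual and block \<open>l < m\<close> the residual of mode \<open>l + d\<close>; the terms with
  a minus sign and the norm of \<open>Y\<close> are free of the unknowns.\<close>

lemma residual_norm_sq:
  assumes B: "B \<in> tensors rs" and D: "\<forall>k<d + m. D k \<in> carrier_mat (ps ! k - rs ! k) (rs ! k)"
  shows "(tensor_norm (drop d ps) (Y - contract (take d ps) A (tangent_vector (d + m) S U V B D)))\<^sup>2 =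
    (tensor_norm (drop d ps) Y)\<^sup>2 - (\<Sum>l\<le>m. (tensor_norm (response.block_dims l) (response.block l Y))\<^sup>2)
    + (tensor_norm (drop d rs) (core_residual d m ps rs S U V A Y B D))\<^sup>2
    + (\<Sum>l<m. mode_residual_sq A Y (l + d) ((D (l + d))\<^sup>T))"
proof -
  let ?E = "response.tangent_blocks (mode_core A) (core_fit A B D) (\<lambda>l. D (l + d))"
  have D': "\<forall>l<m. D (l + d) \<in> carrier_mat (drop d ps ! l - drop d rs ! l) (drop d rs ! l)"
    using D by (auto simp: length_ps length_rs add.commute)
  have fit: "core_fit A B D \<in> tensors (drop d rs)"
    using B D by (intro core_fit_in_tensors) auto
  have "contract (take d ps) A (tangent_vector (d + m) S U V B D) = (\<Sum>l\<le>m. response.embed l (?E l))"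
    unfolding contract_tangent_vector[OF D] by (rule response.tangent_vector_eq_sum_embed[OF D'])
  then have "(tensor_norm (drop d ps) (Y - contract (take d ps) A (tangent_vector (d + m) S U V B D)))\<^sup>2 =
    (tensor_norm (drop d ps) Y)\<^sup>2 - (\<Sum>l\<le>m. (tensor_norm (response.block_dims l) (response.block l Y))\<^sup>2)
    + (\<Sum>l\<le>m. (tensor_norm (response.block_dims l) (response.block l Y - ?E l))\<^sup>2)"
    using response.norm_sq_diff_sum_embed[of ?E Y]
      response.tangent_blocks_in_tensors[OF mode_core_in_tensors fit D'] by simp
  also have "(\<Sum>l\<le>m. (tensor_norm (response.block_dims l) (response.block l Y - ?E l))\<^sup>2) =
      (\<Sum>l<m. (tensor_norm (response.block_dims l) (response.block l Y - ?E l))\<^sup>2)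
      + (tensor_norm (drop d rs) (core_residual d m ps rs S U V A Y B D))\<^sup>2"
    by (simp add: lessThan_Suc_atMost[symmetric] core_residual_eq core_response_eq_block
        response.block_dims_last response.tangent_blocks_def)
  also have "(\<Sum>l<m. (tensor_norm (response.block_dims l) (response.block l Y - ?E l))\<^sup>2) =
      (\<Sum>l<m. mode_residual_sq A Y (l + d) ((D (l + d))\<^sup>T))"
    using D by (intro sum.cong refl) (simp add: mode_residual_sq_eq response.tangent_blocks_def add.commute)
  finally show ?thesis by (simp only: add_ac)
qed

text \<open>At a fixed response index each contraction is an inner product with a slice. Its
  matricized form has \<open>D k\<close> times a matricized slice of \<open>S\<close> on the right,
  and the latter is moved to the other side.\<close>

lemma core_residual_entry:
  assumes D: "\<forall>k<d. D k \<in> carrier_mat (ps ! k - rs ! k) (rs ! k)"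
  shows "core_residual d m ps rs S U V A Y B D js =
    core_response d m U Y js
    - tensor_inner (take d rs) (core_covariate d U A) (slice B js)
    - (\<Sum>k<d. mat_inner
         ((V k)\<^sup>T * matricize ((take d rs)[k := ps ! k]) k (modes_prod (other_modes d k) (\<lambda>j. (U j)\<^sup>T) A)
          * (matricize (take d rs) k (slice S js))\<^sup>T) (D k))"
proof -
  have "contract ((take d rs)[k := ps ! k - rs ! k])
      (modes_prod (other_modes d k) (\<lambda>j. (U j)\<^sup>T) (mode_prod k ((V k)\<^sup>T) A)) (mode_prod k (D k) S) js =
    mat_inner
         ((V k)\<^sup>T * matricize ((take d rs)[k := ps ! k]) k (modes_prod (other_modes d k) (\<lambda>j. (U j)\<^sup>T) A)
          * (matricize (take d rs) k (slice S js))\<^sup>T) (D k)" if k: "k < d" for k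
  proof -
    let ?q = "(take d rs)[k := ps ! k - rs ! k]"
    let ?A = "modes_prod (other_modes d k) (\<lambda>j. (U j)\<^sup>T) A"
    let ?c = "prod_list (take k (take d rs) @ drop (Suc k) (take d rs))"
    have Dk: "D k \<in> carrier_mat (ps ! k - rs ! k) (rs ! k)" and Vk: "V k \<in> carrier_mat (ps ! k) (ps ! k - rs ! k)"
      using D V_carrier[of k] k by auto
    have "modes_prod (other_modes d k) (\<lambda>j. (U j)\<^sup>T) (mode_prod k ((V k)\<^sup>T) A) = mode_prod k ((V k)\<^sup>T) ?A"
      by (simp add: mode_prod_modes_prod other_modes_def)
    moreover have "contract ?q Z (mode_prod k (D k) S) js = tensor_inner ?q Z (mode_prod k (D k) (slice S js))" for Z
      unfolding contract_eq_inner using k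
      by (intro tensor_inner_cong) (auto simp: slice_mode_prod length_tensor_index length_rs)
    moreover have "tensor_inner ?q (mode_prod k ((V k)\<^sup>T) ?A) (mode_prod k (D k) (slice S js)) =
        mat_inner (matricize ?q k (mode_prod k ((V k)\<^sup>T) ?A)) (matricize ?q k (mode_prod k (D k) (slice S js)))"
      using k by (intro mat_inner_matricize[symmetric]) (simp add: length_rs)
    moreover have "matricize ?q k (mode_prod k ((V k)\<^sup>T) ?A) = (V k)\<^sup>T * matricize ((take d rs)[k := ps ! k]) k ?A"
      using Vk k by (simp add: matricize_mode_prod[where b = "ps ! k"] length_rs)
    moreover have "matricize ?q k (mode_prod k (D k) (slice S js)) = D k * matricize (take d rs) k (slice S js)"
      using Dk k by (simp add: matricize_mode_prod[where b = "rs ! k"] length_rs take_rs_update)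
    moreover have "mat_inner ((V k)\<^sup>T * matricize ((take d rs)[k := ps ! k]) k ?A
          * (matricize (take d rs) k (slice S js))\<^sup>T) (D k) =
        mat_inner ((V k)\<^sup>T * matricize ((take d rs)[k := ps ! k]) k ?A) (D k * matricize (take d rs) k (slice S js))"
      using Vk Dk k matricize_carrier[of "(take d rs)[k := ps ! k]" k ?A] matricize_carrier[of "take d rs" k "slice S js"]
      by (intro mat_inner_mult_transpose[where c = ?c]) (auto simp: length_rs intro!: mult_carrier_mat)
    ultimately show ?thesis by simp
  qed
  then show ?thesis
    by (simp add: core_residual_def sum_fun_apply contract_eq_inner[of "take d rs"])
qed

lemma core_objective_entrywise:
  assumes "\<forall>k<d. D k \<in> carrier_mat (ps ! k - rs ! k) (rs ! k)"
  shows "core_objective d m n ps rs S U V A Y B D = core_objective_entrywise d m n ps rs S U V A Y B D"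
  unfolding core_objective_def core_objective_entrywise_def tensor_norm_sq
  unfolding tensor_inner_def[of "drop d rs"] power2_eq_square
  unfolding core_residual_entry[OF assms] ..

end

section \<open>The design matrix\<close>

lemma scalar_prod_vec_of_list:
  fixes xs ys :: "real list"
  assumes "length xs = length ys"
  shows "vec_of_list xs \<bullet> vec_of_list ys = sum_list (map2 (*) xs ys)"
  using assms by (simp add: scalar_prod_def sum_list_sum_nth vec_of_list_index)

lemma sum_list_map2_concat:
  fixes f g :: "'k \<Rightarrow> real list"
  assumes "\<And>k. k \<in> set ks \<Longrightarrow> length (f k) = length (g k)"
  shows "sum_list (map2 (*) (concat (map f ks)) (concat (map g ks))) =
    (\<Sum>k\<leftarrow>ks. sum_list (map2 (*) (f k) (g k)))"
  using assms by (induction ks) auto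

lemma length_tensor_to_list: "length (tensor_to_list ps X) = prod_list ps"
  by (simp add: tensor_to_list_def)

lemma sum_list_tensor_to_list:
  "sum_list (map2 (*) (tensor_to_list ps X) (tensor_to_list ps Z)) = tensor_inner ps X Z"
  unfolding tensor_inner_def sum_multi_index[symmetric]
  by (simp add: tensor_to_list_def zip_map_map zip_same_conv_map o_def interv_sum_list_conv_sum_set_nat
      lessThan_atLeast0)

lemma mat_to_list_eq: "mat_to_list M = concat (map (\<lambda>j. list_of_vec (col M j)) [0..<dim_col M])"
  by (simp add: mat_to_list_def cols_def o_def)

lemma length_mat_to_list: "length (mat_to_list M) = dim_col M * dim_row M"
  by (simp add: mat_to_list_eq length_concat o_def interv_sum_list_conv_sum_set_nat)

lemma sum_list_mat_to_list:
  assumes "M \<in> carrier_mat a b" "N \<in> carrier_mat a b"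
  shows "sum_list (map2 (*) (mat_to_list M) (mat_to_list N)) = mat_inner M N"
proof -
  have "sum_list (map2 (*) (list_of_vec (col M j)) (list_of_vec (col N j))) =
      (\<Sum>i<a. M $$ (i, j) * N $$ (i, j))" if "j < b" for j
    using assms that
    by (simp add: list_of_vec_map zip_map_map zip_same_conv_map o_def interv_sum_list_conv_sum_set_nat lessThan_atLeast0)
  then have "sum_list (map2 (*) (mat_to_list M) (mat_to_list N)) = (\<Sum>j<b. \<Sum>i<a. M $$ (i, j) * N $$ (i, j))"
    using assms by (simp add: mat_to_list_eq sum_list_map2_concat interv_sum_list_conv_sum_set_nat lessThan_atLeast0)
  also have "\<dots> = mat_inner M N"
    unfolding mat_inner_def using assms by (simp add: sum.swap[of _ "{..<a}"])
  finally show ?thesis .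
qed

lemma dim_core_unknowns:
  assumes "\<forall>k<d. D k \<in> carrier_mat (q k) (r k)"
  shows "dim_vec (core_unknowns d rs B D) = prod_list rs + (\<Sum>k<d. r k * q k)"
proof -
  have "(\<Sum>k\<in>{0..<d}. dim_col (D k) * dim_row (D k)) = (\<Sum>k<d. r k * q k)"
    using assms by (intro sum.cong) auto
  then show ?thesis
    by (simp add: core_unknowns_def length_tensor_to_list length_concat length_mat_to_list o_def
        interv_sum_list_conv_sum_set_nat)
qed

text \<open>Corresponding segments of the two coordinate lists have equal lengths, so the scalar
  product splits over them. Rows of the design matrix can thus be handled as a tensor and
  matrices.\<close>

lemma scalar_prod_core_unknowns:
  assumes "\<forall>k<d. D k \<in> carrier_mat (q k) (r k)" "\<forall>k<d. D' k \<in> carrier_mat (q k) (r k)"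
  shows "core_unknowns d rs B D \<bullet> core_unknowns d rs B' D' =
    tensor_inner rs B B' + (\<Sum>k<d. mat_inner (D k) (D' k))"
proof -
  have len: "length (mat_to_list (D k)) = length (mat_to_list (D' k))" if "k < d" for k
    using assms that by (metis carrier_matD length_mat_to_list)
  have "(\<Sum>k\<leftarrow>[0..<d]. sum_list (map2 (*) (mat_to_list (D k)) (mat_to_list (D' k)))) =
      (\<Sum>k<d. mat_inner (D k) (D' k))"
    using assms by (auto simp: interv_sum_list_conv_sum_set_nat sum_list_mat_to_list intro!: sum.cong)
  moreover have "length (concat (map (\<lambda>k. mat_to_list (D k)) [0..<d])) =
      length (concat (map (\<lambda>k. mat_to_list (D' k)) [0..<d]))"
    using len by (auto simp: length_concat o_def interv_sum_list_conv_sum_set_nat intro!: sum.cong)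
  ultimately show ?thesis
    using sum_list_map2_concat[of "[0..<d]" "\<lambda>k. mat_to_list (D k)" "\<lambda>k. mat_to_list (D' k)"] len
    by (simp add: core_unknowns_def scalar_prod_vec_of_list length_tensor_to_list
        sum_list_tensor_to_list)
qed

lemma multi_index_in_tensor_indices:
  "c < prod_list ps \<Longrightarrow> multi_index ps c \<in> tensor_indices ps"
proof (induction ps arbitrary: c)
  case (Cons p ps)
  then have "p > 0" by (cases p) auto
  with Cons show ?case
    by (auto simp: tensor_indices_Cons less_mult_imp_div_less mult.commute)
qed simp

text \<open>The fitted part of each residual entry is the inner product of \<open>(B, D)\<close> with coefficients of the
  same shape, so the rows of the design matrix are again vectors of the form \<open>core_unknowns\<close>.\<close>

lemma (in tucker_regression) core_residual_affine:
  "\<exists>M \<in> carrier_mat (n * prod_list (drop d rs)) (prod_list rs + (\<Sum>k<d. rs ! k * (ps ! k - rs ! k))).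
    \<exists>y \<in> carrier_vec (n * prod_list (drop d rs)).
      \<forall>B D. (\<forall>k<d. D k \<in> carrier_mat (ps ! k - rs ! k) (rs ! k)) \<longrightarrow>
        core_residual_vec d m n ps rs S U V A Y B D = y - M *\<^sub>v core_unknowns d rs B D"
proof -
  let ?a = "n * prod_list (drop d rs)" and ?b = "prod_list rs + (\<Sum>k<d. rs ! k * (ps ! k - rs ! k))"
  let ?ix = "multi_index (n # drop d rs)"
  \<comment> \<open>The coefficients of \<open>B\<close> in entry \<open>js\<close> of sample
    \<open>i\<close>: the covariate placed on the slice at \<open>js\<close>, zero elsewhere, so
    that the inner product selects that slice of \<open>B\<close>.\<close>
  define Bc where "Bc i js = (\<lambda>is. if drop d is = js then core_covariate d U (A i) (take d is) else 0)"
    for i :: nat and js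
  define Dc where "Dc i js k = (V k)\<^sup>T
        * matricize ((take d rs)[k := ps ! k]) k (modes_prod (other_modes d k) (\<lambda>j. (U j)\<^sup>T) (A i))
        * (matricize (take d rs) k (slice S js))\<^sup>T" for i :: nat and js k
  \<comment> \<open>The head of the decoded multi-index is the sample, its tail the response
    index.\<close>
  define R where "R c = core_unknowns d rs (Bc (hd (?ix c)) (tl (?ix c))) (Dc (hd (?ix c)) (tl (?ix c)))" for c
  define M where "M = mat ?a ?b (\<lambda>(c, j). R c $ j)"
  define y where "y = vec_of_list (tensor_to_list (n # drop d rs) (stack n (\<lambda>i. core_response d m U (Y i))))"
  have Dc: "\<forall>k<d. Dc i js k \<in> carrier_mat (ps ! k - rs ! k) (rs ! k)" for i js
  proof (intro allI impI)
    fix k assume "k < d"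
    then show "Dc i js k \<in> carrier_mat (ps ! k - rs ! k) (rs ! k)"
      using V_carrier[of k] matricize_carrier[of "take d rs" k "slice S js"]
        matricize_carrier[of "(take d rs)[k := ps ! k]" k "modes_prod (other_modes d k) (\<lambda>j. (U j)\<^sup>T) (A i)"]
      by (auto simp: Dc_def length_rs intro!: mult_carrier_mat)
  qed
  have Bc: "tensor_inner rs (Bc i js) B = tensor_inner (take d rs) (core_covariate d U (A i)) (slice B js)"
    if js: "js \<in> tensor_indices (drop d rs)" for i js B
  proof -
    have "tensor_inner rs (Bc i js) B = (\<Sum>ks\<in>tensor_indices (take d rs). \<Sum>js'\<in>tensor_indices (drop d rs).
        Bc i js (ks @ js') * B (ks @ js'))"
      unfolding tensor_inner_def using sum_tensor_indices_append[of _ "take d rs" "drop d rs"] by simp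
    also have "\<dots> = (\<Sum>ks\<in>tensor_indices (take d rs). \<Sum>js'\<in>tensor_indices (drop d rs).
        if js' = js then core_covariate d U (A i) ks * B (ks @ js) else 0)"
      by (intro sum.cong refl) (auto simp: Bc_def length_tensor_index length_rs)
    also have "\<dots> = tensor_inner (take d rs) (core_covariate d U (A i)) (slice B js)"
      using js by (simp add: tensor_inner_def slice_def)
    finally show ?thesis .
  qed
  have "core_residual_vec d m n ps rs S U V A Y B D = y - M *\<^sub>v core_unknowns d rs B D"
    if D: "\<forall>k<d. D k \<in> carrier_mat (ps ! k - rs ! k) (rs ! k)" for B D
  proof (rule eq_vecI)
    show "dim_vec (core_residual_vec d m n ps rs S U V A Y B D) = dim_vec (y - M *\<^sub>v core_unknowns d rs B D)"
      by (simp add: core_residual_vec_def y_def M_def length_tensor_to_list)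
    fix c assume "c < dim_vec (y - M *\<^sub>v core_unknowns d rs B D)"
    then have c: "c < ?a" by (simp add: M_def)
    obtain i js where ix: "?ix c = i # js" by simp
    have "i # js \<in> tensor_indices (n # drop d rs)"
      using multi_index_in_tensor_indices[of c "n # drop d rs"] c unfolding ix by simp
    then have i: "i < n" and js: "js \<in> tensor_indices (drop d rs)"
      by (auto simp: tensor_indices_Cons)
    have R: "R c = core_unknowns d rs (Bc i js) (Dc i js)"
      by (simp only: R_def ix list.sel)
    have "row M c = R c"
      using c dim_core_unknowns[OF Dc[of i js], of rs "Bc i js"]
      by (intro eq_vecI) (auto simp: M_def R)
    then have "(M *\<^sub>v core_unknowns d rs B D) $ c = R c \<bullet> core_unknowns d rs B D"
      using c by (simp add: M_def)
    also have "\<dots> = tensor_inner (take d rs) (core_covariate d U (A i)) (slice B js)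
        + (\<Sum>k<d. mat_inner (Dc i js k) (D k))"
      unfolding R scalar_prod_core_unknowns[OF Dc D] Bc[OF js] ..
    finally have Mx: "(M *\<^sub>v core_unknowns d rs B D) $ c =
        tensor_inner (take d rs) (core_covariate d U (A i)) (slice B js)
        + (\<Sum>k<d. mat_inner (Dc i js k) (D k))" .
    have "y $ c = core_response d m U (Y i) js"
      using c i ix by (simp add: y_def vec_of_list_index tensor_to_list_def stack_def)
    moreover have "core_residual_vec d m n ps rs S U V A Y B D $ c =
        core_residual d m ps rs S U V (A i) (Y i) B D js"
      using c i ix by (simp add: core_residual_vec_def vec_of_list_index tensor_to_list_def stack_def)
    ultimately show "core_residual_vec d m n ps rs S U V A Y B D $ c = (y - M *\<^sub>v core_unknowns d rs B D) $ c"
      using c Mx core_residual_entry[OF D, of "A i" "Y i" B js]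
      by (simp add: M_def Dc_def)
  qed
  moreover have "M \<in> carrier_mat ?a ?b" by (simp add: M_def)
  moreover have "y \<in> carrier_vec ?a"
    by (intro carrier_vecI) (simp add: y_def length_tensor_to_list)
  ultimately show ?thesis by blast
qed

lemma core_objective_eq_scalar_prod:
  "core_objective d m n ps rs S U V A Y B D =
     core_residual_vec d m n ps rs S U V A Y B D \<bullet> core_residual_vec d m n ps rs S U V A Y B D"
  by (simp add: core_residual_vec_def scalar_prod_vec_of_list sum_list_tensor_to_list
      core_objective_def flip: tensor_norm_sq tensor_norm_sq_stack)

section \<open>Products of mode sizes\<close>

lemma prod_list_eq_prod_nth: "prod_list xs = (\<Prod>k<length xs. xs ! k)"
  for xs :: "nat list"
  by (simp add: prod.list_conv_set_nth lessThan_atLeast0)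

lemma prod_list_drop:
  fixes xs :: "nat list"
  assumes "length xs = d + m"
  shows "prod_list (drop d xs) = (\<Prod>k\<in>{d..<d + m}. xs ! k)"
proof -
  have "prod_list (drop d xs) = (\<Prod>k\<in>{0..<m}. xs ! (k + d))"
    using assms by (simp add: prod_list_eq_prod_nth lessThan_atLeast0 add.commute)
  also have "\<dots> = (\<Prod>k\<in>{d..<d + m}. xs ! k)"
    using prod.shift_bounds_nat_ivl[of "\<lambda>k. xs ! k" 0 d m] by (simp add: add.commute)
  finally show ?thesis .
qed

lemma prod_list_drop_remove:
  fixes xs :: "nat list"
  assumes "length xs = d + m" "l < m"
  shows "prod_list (take l (drop d xs) @ drop (Suc l) (drop d xs)) = (\<Prod>k\<in>{d..<d + m} - {l + d}. xs ! k)"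
proof -
  have "{d..<d + m} - {l + d} = {d..<d + l} \<union> {Suc (d + l)..<d + m}"
    using assms(2) by auto
  moreover have "{d..<d + l} \<inter> {Suc (d + l)..<d + m} = {}" by auto
  ultimately have "(\<Prod>k\<in>{d..<d + m} - {l + d}. xs ! k) =
      (\<Prod>k\<in>{d..<d + l}. xs ! k) * (\<Prod>k\<in>{Suc (d + l)..<d + m}. xs ! k)"
    by (simp add: prod.union_disjoint)
  moreover have "prod_list (take l (drop d xs)) = (\<Prod>k\<in>{d..<d + l}. xs ! k)"
    using assms prod_list_drop[of "take (d + l) xs" d l] by (simp add: take_drop add.commute)
  moreover have "prod_list (drop (Suc l) (drop d xs)) = (\<Prod>k\<in>{Suc (d + l)..<d + m}. xs ! k)"
    using assms prod_list_drop[of xs "Suc (d + l)" "m - Suc l"] by (simp add: add.commute)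
  ultimately show ?thesis by simp
qed

section \<open>The least squares update\<close>

text \<open>A feasible point no worse than the minimizer is itself a minimizer. Uniqueness thus
  becomes a comparison of two values, without a proof that the competitor is minimal.\<close>

lemma is_unique_arg_min_iff:
  "is_unique_arg_min f P x \<longleftrightarrow> P x \<and> (\<forall>y. P y \<longrightarrow> f x \<le> f y \<and> (f y \<le> f x \<longrightarrow> y = x))"
  (is "?l \<longleftrightarrow> ?r")
proof
  assume l: ?l
  then have x: "P x" "\<And>y. P y \<Longrightarrow> f x \<le> f y"
    by (auto simp: is_unique_arg_min_def is_arg_min_def not_less)
  moreover have "y = x" if "P y" "f y \<le> f x" for y
  proof -
    have "is_arg_min f P y"
      unfolding is_arg_min_def not_ex using that x by (auto simp: not_less intro: order_trans)
    with l show ?thesis by (simp add: is_unique_arg_min_def)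
  qed
  ultimately show ?r by blast
next
  assume ?r
  then show ?l by (auto simp: is_unique_arg_min_def is_arg_min_def not_less)
qed

theorem proposition2:
  fixes d m n :: nat and ps rs :: "nat list"
    and A Y :: "nat \<Rightarrow> tensor" and X S Xhalf :: tensor and U V :: "nat \<Rightarrow> real mat"
  assumes "d \<ge> 1"
    and "length ps = d + m" and "length rs = d + m"
    and "\<And>i. i < n \<Longrightarrow> A i \<in> tensors (take d ps)"
    and "\<And>i. i < n \<Longrightarrow> Y i \<in> tensors (drop d ps)"
    and "X \<in> tucker_manifold ps rs"
    and "tucker_decomposition ps rs X S U"
    and "\<And>k. k < d + m \<Longrightarrow> orthonormal_complement (U k) (V k)"
    and "is_unique_arg_min
           (\<lambda>Z. 1 / 2 * (tensor_norm (n # drop d ps)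
              (stack n Y - measurement_op (take d ps) n A
                 (orth_projector ps (tangent_space ps rs S U V) Z)))\<^sup>2)
           (\<lambda>Z. Z \<in> tangent_space ps rs S U V) Xhalf"
  shows
    "(\<exists>B D. B \<in> tensors rs \<and> (\<forall>k<d + m. D k \<in> carrier_mat (ps ! k - rs ! k) (rs ! k)) \<and>
        Xhalf = tangent_vector (d + m) S U V B D \<and>
        is_unique_arg_min
          (\<lambda>(B', D'). core_objective d m n ps rs S U V A Y B' D')
          (\<lambda>(B', D'). B' \<in> tensors rs \<and>
             D' \<in> (\<Pi>\<^sub>E k\<in>{..<d}. carrier_mat (ps ! k - rs ! k) (rs ! k)))
          (B, restrict D {..<d}) \<and>
        (\<forall>k\<in>{d..<d + m}.
          is_unique_arg_min
            (\<lambda>E. \<Sum>i<n. (mat_norm (mode_response d m ps rs U V (Y i) k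
                                - mode_covariate d rs S U (A i) k * E))\<^sup>2)
            (\<lambda>E. E \<in> carrier_mat (rs ! k) (ps ! k - rs ! k))
            ((D k)\<^sup>T))) \<and>
     (\<exists>M \<in> carrier_mat (n * (\<Prod>l\<in>{d..<d + m}. rs ! l))
                      ((\<Prod>k<d + m. rs ! k) + (\<Sum>k<d. rs ! k * (ps ! k - rs ! k))).
      \<exists>y \<in> carrier_vec (n * (\<Prod>l\<in>{d..<d + m}. rs ! l)).
        \<forall>B\<in>tensors rs. \<forall>D. (\<forall>k<d. D k \<in> carrier_mat (ps ! k - rs ! k) (rs ! k)) \<longrightarrow>
          core_residual_vec d m n ps rs S U V A Y B D = y - M *\<^sub>v core_unknowns d rs B D \<and>
          core_objective d m n ps rs S U V A Y B D =
            (y - M *\<^sub>v core_unknowns d rs B D) \<bullet> (y - M *\<^sub>v core_unknowns d rs B D)) \<and>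
     (\<forall>B\<in>tensors rs. \<forall>D. (\<forall>k<d. D k \<in> carrier_mat (ps ! k - rs ! k) (rs ! k)) \<longrightarrow>
        core_objective d m n ps rs S U V A Y B D =
        core_objective_entrywise d m n ps rs S U V A Y B D) \<and>
     (\<forall>k\<in>{d..<d + m}. \<forall>i<n.
        mode_covariate d rs S U (A i) k
          \<in> carrier_mat (\<Prod>l\<in>{d..<d + m} - {k}. rs ! l) (rs ! k) \<and>
        mode_response d m ps rs U V (Y i) k
          \<in> carrier_mat (\<Prod>l\<in>{d..<d + m} - {k}. rs ! l) (ps ! k - rs ! k))"
proof -
  have X: "tucker_rank ps X = rs" "X = modes_prod [0..<d + m] U S"
    using assms(2,6,7) by (simp_all add: tucker_manifold_def tucker_decomposition_def)
  interpret tucker_regression d m ps rs S U V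
    using assms(2,3,7,8)
    by unfold_locales (auto simp: tucker_decomposition_def)
  let ?T = "tangent_space ps rs S U V" and ?tv = "tangent_vector (d + m) S U V"
  let ?carr = "\<lambda>N D. \<forall>k<N. D k \<in> carrier_mat (ps ! k - rs ! k) (rs ! k)"
  let ?f = "\<lambda>Z. 1 / 2 * (tensor_norm (n # drop d ps)
              (stack n Y - measurement_op (take d ps) n A (orth_projector ps ?T Z)))\<^sup>2"
  let ?core = "core_objective d m n ps rs S U V A Y"
  \<comment> \<open>\<open>h k\<close> is the least squares objective for mode \<open>k\<close>, and
    \<open>c\<close> collects all terms free of the unknowns.\<close>
  define h where "h k E = (\<Sum>i<n. mode_residual_sq (A i) (Y i) k E)" for k E
  define c where "c = (\<Sum>i<n. (tensor_norm (drop d ps) (Y i))\<^sup>2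
    - (\<Sum>l\<le>m. (tensor_norm (response.block_dims l) (response.block l (Y i)))\<^sup>2))"
  have in_T: "?tv B D \<in> ?T" if "B \<in> tensors rs" "?carr (d + m) D" for B D
    using that assms(2) by (auto simp: tangent_space_def)
  have objective: "?f (?tv B D) = 1 / 2 * (c + ?core B D + (\<Sum>l<m. h (l + d) ((D (l + d))\<^sup>T)))"
    if BD: "B \<in> tensors rs" "?carr (d + m) D" for B D
  proof -
    have "?f (?tv B D) = 1 / 2 * (\<Sum>i<n. (tensor_norm (drop d ps) (Y i - contract (take d ps) (A i) (?tv B D)))\<^sup>2)"
      unfolding orth_projector_tangent_space[OF S_tensor in_T[OF BD]] measurement_op_def stack_diff
        tensor_norm_sq_stack ..
    also have "\<dots> = 1 / 2 * (c + ?core B D + (\<Sum>i<n. \<Sum>l<m. mode_residual_sq (A i) (Y i) (l + d) ((D (l + d))\<^sup>T)))"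
      unfolding residual_norm_sq[OF BD] c_def core_objective_def by (simp only: sum.distrib)
    also have "(\<Sum>i<n. \<Sum>l<m. mode_residual_sq (A i) (Y i) (l + d) ((D (l + d))\<^sup>T)) =
        (\<Sum>l<m. h (l + d) ((D (l + d))\<^sup>T))"
      unfolding h_def by (rule sum.swap)
    finally show ?thesis .
  qed
  have core_cong: "?core B D = ?core B D'" if "\<And>k. k < d \<Longrightarrow> D k = D' k" for B D D'
    unfolding core_objective_def core_residual_def using that by simp
  have Xhalf: "Xhalf \<in> ?T" and min: "\<And>Z. Z \<in> ?T \<Longrightarrow> ?f Xhalf \<le> ?f Z"
    and uniq: "\<And>Z. Z \<in> ?T \<Longrightarrow> ?f Z \<le> ?f Xhalf \<Longrightarrow> Z = Xhalf"
    using assms(9) unfolding is_unique_arg_min_iff by blast+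
  obtain B D where B: "B \<in> tensors rs" and D: "?carr (d + m) D" and Xh: "Xhalf = ?tv B D"
    using Xhalf assms(2) by (auto simp: tangent_space_def)
  \<comment> \<open>Minimality and uniqueness pass from tangent vectors to their parameters:
    \<open>c\<close> and the factor \<open>1 / 2\<close> cancel, and injectivity of the
    parametrisation identifies the parameters.\<close>
  have competitor:
    "?core B D + (\<Sum>l<m. h (l + d) ((D (l + d))\<^sup>T)) \<le> ?core B' D' + (\<Sum>l<m. h (l + d) ((D' (l + d))\<^sup>T))"
    "?core B' D' + (\<Sum>l<m. h (l + d) ((D' (l + d))\<^sup>T)) \<le> ?core B D + (\<Sum>l<m. h (l + d) ((D (l + d))\<^sup>T)) \<Longrightarrow>
      B' = B \<and> (\<forall>k<d + m. D' k = D k)" if BD': "B' \<in> tensors rs" "?carr (d + m) D'" for B' D'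
  proof -
    show "?core B D + (\<Sum>l<m. h (l + d) ((D (l + d))\<^sup>T)) \<le> ?core B' D' + (\<Sum>l<m. h (l + d) ((D' (l + d))\<^sup>T))"
      using min[OF in_T[OF BD']] unfolding Xh objective[OF B D] objective[OF BD'] by simp
    assume "?core B' D' + (\<Sum>l<m. h (l + d) ((D' (l + d))\<^sup>T)) \<le> ?core B D + (\<Sum>l<m. h (l + d) ((D (l + d))\<^sup>T))"
    then have "?f (?tv B' D') \<le> ?f Xhalf"
      unfolding Xh objective[OF B D] objective[OF BD'] by simp
    then have "?tv B' D' = ?tv B D"
      using uniq[OF in_T[OF BD']] Xh by simp
    then show "B' = B \<and> (\<forall>k<d + m. D' k = D k)"
      using tangent_vector_inject[OF S_tensor BD'(1) B BD'(2) D] X by simp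
  qed
  have "is_unique_arg_min (\<lambda>(B', D'). ?core B' D')
      (\<lambda>(B', D'). B' \<in> tensors rs \<and> D' \<in> (\<Pi>\<^sub>E k\<in>{..<d}. carrier_mat (ps ! k - rs ! k) (rs ! k)))
      (B, restrict D {..<d})"
  proof -
    have core_D: "?core B (restrict D {..<d}) = ?core B D"
      by (rule core_cong) simp
    have min_core: "?core B D \<le> ?core B' D'" "?core B' D' \<le> ?core B D \<Longrightarrow> B' = B \<and> D' = restrict D {..<d}"
      if B': "B' \<in> tensors rs" and D': "D' \<in> (\<Pi>\<^sub>E k\<in>{..<d}. carrier_mat (ps ! k - rs ! k) (rs ! k))" for B' D'
    proof -
      \<comment> \<open>A competitor of the core problem is completed by the optimal
        \<open>D k\<close> for \<open>k \<ge> d\<close>, so that the mode terms agree on both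
        sides.\<close>
      define E where "E k = (if k < d then D' k else D k)" for k
      have E: "?carr (d + m) E" using D' D by (auto simp: E_def PiE_iff)
      have eq: "?core B' E = ?core B' D'" by (rule core_cong) (simp add: E_def)
      have sum_eq: "(\<Sum>l<m. h (l + d) ((E (l + d))\<^sup>T)) = (\<Sum>l<m. h (l + d) ((D (l + d))\<^sup>T))"
        by (simp add: E_def)
      show "?core B D \<le> ?core B' D'"
        using competitor(1)[OF B' E] eq sum_eq by simp
      assume "?core B' D' \<le> ?core B D"
      then have "B' = B" and DE: "\<forall>k<d + m. E k = D k"
        using competitor(2)[OF B' E] eq sum_eq by auto
      \<comment> \<open>Outside \<open>{..<d}\<close> both functions have the default value
        \<open>undefined\<close>; the extensional function space is what allows uniqueness as
        equality of functions.\<close>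
      moreover have "D' = restrict D {..<d}"
      proof
        fix k show "D' k = restrict D {..<d} k"
          using D' DE[rule_format, of k] by (cases "k < d") (auto simp: E_def PiE_iff extensional_def)
      qed
      ultimately show "B' = B \<and> D' = restrict D {..<d}" by simp
    qed
    show ?thesis
      unfolding is_unique_arg_min_iff
      using B D min_core by (auto simp: core_D)
  qed
  moreover have "\<forall>k\<in>{d..<d + m}. is_unique_arg_min (h k) (\<lambda>E. E \<in> carrier_mat (rs ! k) (ps ! k - rs ! k)) ((D k)\<^sup>T)"
  proof
    fix k assume k: "k \<in> {d..<d + m}"
    have min_h: "h k ((D k)\<^sup>T) \<le> h k E" "h k E \<le> h k ((D k)\<^sup>T) \<Longrightarrow> E = (D k)\<^sup>T"
      if E: "E \<in> carrier_mat (rs ! k) (ps ! k - rs ! k)" for E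
    proof -
      \<comment> \<open>Only mode \<open>k\<close> is changed, so the core objective and all other
        mode terms cancel in the comparison.\<close>
      let ?D = "D(k := E\<^sup>T)"
      have D': "?carr (d + m) ?D" using E D by auto
      have core_eq: "?core B ?D = ?core B D" using k by (intro core_cong) auto
      have sum_h: "(\<Sum>l<m. h (l + d) ((F (l + d))\<^sup>T)) =
          h k ((F k)\<^sup>T) + (\<Sum>l\<in>{..<m} - {k - d}. h (l + d) ((F (l + d))\<^sup>T))" for F
        using k sum.remove[of "{..<m}" "k - d" "\<lambda>l. h (l + d) ((F (l + d))\<^sup>T)"] by auto
      have rest: "(\<Sum>l\<in>{..<m} - {k - d}. h (l + d) ((?D (l + d))\<^sup>T)) =
          (\<Sum>l\<in>{..<m} - {k - d}. h (l + d) ((D (l + d))\<^sup>T))"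
        by (intro sum.cong) auto
      show "h k ((D k)\<^sup>T) \<le> h k E"
        using competitor(1)[OF B D'] unfolding core_eq sum_h rest by simp
      assume "h k E \<le> h k ((D k)\<^sup>T)"
      then have "E\<^sup>T = D k"
        using competitor(2)[OF B D'] k unfolding core_eq sum_h rest by auto
      then show "E = (D k)\<^sup>T" by (metis transpose_transpose)
    qed
    show "is_unique_arg_min (h k) (\<lambda>E. E \<in> carrier_mat (rs ! k) (ps ! k - rs ! k)) ((D k)\<^sup>T)"
      unfolding is_unique_arg_min_iff using D k min_h by auto
  qed
  ultimately have part1: "\<exists>B D. B \<in> tensors rs \<and> ?carr (d + m) D \<and> Xhalf = ?tv B D \<and>
        is_unique_arg_min (\<lambda>(B', D'). ?core B' D')
          (\<lambda>(B', D'). B' \<in> tensors rs \<and>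
             D' \<in> (\<Pi>\<^sub>E k\<in>{..<d}. carrier_mat (ps ! k - rs ! k) (rs ! k)))
          (B, restrict D {..<d}) \<and>
        (\<forall>k\<in>{d..<d + m}.
          is_unique_arg_min
            (\<lambda>E. \<Sum>i<n. (mat_norm (mode_response d m ps rs U V (Y i) k
                                - mode_covariate d rs S U (A i) k * E))\<^sup>2)
            (\<lambda>E. E \<in> carrier_mat (rs ! k) (ps ! k - rs ! k)) ((D k)\<^sup>T))"
    using B D Xh unfolding h_def mode_residual_sq_def by (intro exI[of _ B] exI[of _ D] conjI)
  have dims: "n * (\<Prod>l\<in>{d..<d + m}. rs ! l) = n * prod_list (drop d rs)" "(\<Prod>k<d + m. rs ! k) = prod_list rs"
    using prod_list_drop[OF assms(3)] prod_list_eq_prod_nth[of rs] assms(3) by simp_all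
  have carrier: "mode_covariate d rs S U (A i) k
          \<in> carrier_mat (\<Prod>l\<in>{d..<d + m} - {k}. rs ! l) (rs ! k) \<and>
        mode_response d m ps rs U V (Y i) k
          \<in> carrier_mat (\<Prod>l\<in>{d..<d + m} - {k}. rs ! l) (ps ! k - rs ! k)"
    if k: "k \<in> {d..<d + m}" for k i
  proof -
    have l: "k = (k - d) + d" "k - d < m" using k by auto
    show ?thesis
      using mode_covariate_carrier[OF l(2), of "A i"] mode_response_carrier[OF l(2), of "Y i"]
      unfolding prod_list_drop_remove[OF assms(3) l(2)] l(1)[symmetric] by blast
  qed
  obtain M y where "M \<in> carrier_mat (n * prod_list (drop d rs)) (prod_list rs + (\<Sum>k<d. rs ! k * (ps ! k - rs ! k)))"
    "y \<in> carrier_vec (n * prod_list (drop d rs))"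
    "\<And>B D. ?carr d D \<Longrightarrow> core_residual_vec d m n ps rs S U V A Y B D = y - M *\<^sub>v core_unknowns d rs B D"
    using core_residual_affine[of n A Y] by blast
  then have part2: "\<exists>M \<in> carrier_mat (n * (\<Prod>l\<in>{d..<d + m}. rs ! l))
                      ((\<Prod>k<d + m. rs ! k) + (\<Sum>k<d. rs ! k * (ps ! k - rs ! k))).
      \<exists>y \<in> carrier_vec (n * (\<Prod>l\<in>{d..<d + m}. rs ! l)).
        \<forall>B\<in>tensors rs. \<forall>D. ?carr d D \<longrightarrow>
          core_residual_vec d m n ps rs S U V A Y B D = y - M *\<^sub>v core_unknowns d rs B D \<and>
          ?core B D = (y - M *\<^sub>v core_unknowns d rs B D) \<bullet> (y - M *\<^sub>v core_unknowns d rs B D)"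
    unfolding dims core_objective_eq_scalar_prod by (intro bexI[of _ M] bexI[of _ y]) simp_all
  show ?thesis
    by (rule conjI[OF part1 conjI[OF part2 conjI]]) (use core_objective_entrywise carrier in blast)+
qed

end
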